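(* Let $P=P_a$ be the hNRMI with Lévy intensity $\rho(ds)\,aH(dx)$ (as in the context) and assume $\tilde{\tau}_1=\int_1^\infty s\,\rho(ds)<\infty$. As $a\to\infty$: (i) (Strong law of large numbers) $P\to H$ almost surely in $\mathbb{M}_{\mathbb{X}}$ with respect to the metric $d$, i.e. $d(P,H)\to0$ almost surely. (ii) (Glivenko–Cantelli) If $(\mathbb{X},\mathcal{X})=(\mathbb{R},\mathcal{B}(\mathbb{R}))$, then $\sup_{x\in\mathbb{R}}|P((-\infty,x])-H((-\infty,x])|\to0$ almost surely.
   Context: $(\mathbb{X},\mathcal{X})$ is a complete separable metric space (metric $\eta$) with its Borel $\sigma$-algebra. $\rho$ is a measure on $(0,\infty)$ with $\int_0^\infty\min(s,1)\rho(ds)<\infty$ and $\rho((0,\infty))=\infty$; $H$ is a non-atomic probability measure on $\mathbb{X}$; $a>0$. Realize all $a$ on one probability space: $N$ is a Poisson random measure on $[0,\infty)\times(0,\infty)\times\mathbb{X}$ with mean measure $d\zeta\,\rho(ds)H(dx)$, $\tilde{\mu}_a(A)=\int_0^a\int_0^\infty\int_A s\,N(d\zeta,ds,dx)$ (a completely random measure with Lévy intensity $\rho(ds)\,aH(dx)$), and $P(\cdot)=\tilde{\mu}_a(\cdot)/\tilde{\mu}_a(\mathbb{X})$. $\mathbb{M}_{\mathbb{X}}$ is the space of probability measures on $\mathbb{X}$ with the metric $d(\xi_1,\xi_2)=\sum_{i=1}^\infty 2^{-i}\big(|\int f_i\,d\xi_1-\int f_i\,d\xi_2|\wedge1\big)$,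 where $\{f_i\}_{i\ge1}$ is a countable dense subset of the space $C_b(\mathbb{X},\eta)$ of bounded continuous functions. *)

theory Defs
  imports "HOL-Probability.Probability"
begin

definition poisson_random_measure ::
  "'w measure \<Rightarrow> ('w \<Rightarrow> 'b measure) \<Rightarrow> 'b measure \<Rightarrow> bool" where
  "poisson_random_measure M N nu \<longleftrightarrow>
     prob_space M \<and>
     (\<forall>w\<in>space M. sets (N w) = sets nu) \<and>
     (\<forall>B\<in>sets nu.
        (\<lambda>w. emeasure (N w) B) \<in> borel_measurable M \<and>
        (emeasure nu B < \<infinity> \<longrightarrow>
           (\<forall>k::nat. measure M {w\<in>space M. emeasure (N w) B = of_nat k}
              = exp (- enn2real (emeasure nu B)) * enn2real (emeasure nu B) ^ k / fact k)) \<and>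
        (emeasure nu B = \<infinity> \<longrightarrow> (AE w in M. emeasure (N w) B = \<infinity>))) \<and>
     (\<forall>(n::nat) (B::nat \<Rightarrow> 'b set).
        (\<forall>i<n. B i \<in> sets nu) \<and> disjoint_family_on B {..<n} \<longrightarrow>
        prob_space.indep_vars M (\<lambda>_. borel) (\<lambda>i w. emeasure (N w) (B i)) {..<n})"

definition mean_measure :: "real measure \<Rightarrow> 'a measure \<Rightarrow> (real \<times> real \<times> 'a) measure" where
  "mean_measure rho H =
     density (lborel \<Otimes>\<^sub>M (rho \<Otimes>\<^sub>M H))
       (indicator ({0..} \<times> {0<..} \<times> UNIV))"

definition crm :: "('w \<Rightarrow> (real \<times> real \<times> 'a::topological_space) measure) \<Rightarrow> real \<Rightarrow> 'w \<Rightarrow> 'a measure" where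
  "crm N a w =
     distr (density (N w) (\<lambda>z. ennreal (fst (snd z)) * indicator ({0..a} \<times> UNIV) z))
       (borel :: 'a measure) (\<lambda>z. snd (snd z))"

definition hnrmi :: "('w \<Rightarrow> (real \<times> real \<times> 'a::topological_space) measure) \<Rightarrow> real \<Rightarrow> 'w \<Rightarrow> 'a measure" where
  "hnrmi N a w = density (crm N a w) (\<lambda>_. inverse (emeasure (crm N a w) (space (crm N a w))))"

text \<open>The metric d(xi1,xi2) = sum_{i>=1} 2^-i (|int f_i dxi1 - int f_i dxi2| min 1),
  with the sequence (f_i) indexed from 0 here (f 0 plays the role of f_1).\<close>
definition dM :: "(nat \<Rightarrow> 'a \<Rightarrow> real) \<Rightarrow> 'a measure \<Rightarrow> 'a measure \<Rightarrow> real" where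
  "dM f xi1 xi2 =
     (\<Sum>i. (1/2) ^ Suc i * min \<bar>(\<integral>x. f i x \<partial>xi1) - (\<integral>x. f i x \<partial>xi2)\<bar> 1)"

end

theory Submission
  imports Defs
begin

text \<open>
  For a bounded function \<open>g \<ge> 0\<close> the integral of \<open>g\<close> against the completely random measure is
  nondecreasing in \<open>a\<close> and, by Campbell's formula, has mean \<open>a\<close> times \<open>\<integral> s d\<rho>\<close> times
  \<open>\<integral> g dH\<close>, which is finite. Etemadi's method gives the strong law for it: along
  \<open>a = b ^ k\<close> truncate the jumps at \<open>b ^ k\<close>, bound the variance of the truncated integral by
  Campbell's second-moment formula, and interpolate by monotonicity, letting \<open>b\<close> decrease to 1.
  Dividing by the case \<open>g = 1\<close> gives convergence of the normalized integrals, and countably many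
  \<open>g\<close> at once suffice: the \<open>f i\<close> for the metric, and indicators of half-lines at quantiles of \<open>H\<close>
  for the uniform statement.
\<close>

text \<open>The hypothesis on \<open>N\<close> speaks of counts: Poisson laws of single sets and
  independence over disjoint sets. Both Campbell formulas therefore have to be built up from
  indicators. The parameter \<open>a\<close> is real, so a law for each fixed \<open>a\<close> would
  leave uncountably many null sets; the countable family \<open>b = 1 + 1/(j+1)\<close> together
  with monotonicity leaves a single one. Only a first moment of \<open>rho\<close> is available, and
  truncating sizes at the same level \<open>b ^ k\<close> as times makes both error series, after
  exchanging sum and integral, at most \<open>b / (b - 1)\<close> times that moment. Infinite mass
  of \<open>rho\<close> on the positive axis enters as positivity of the moment, which makes the
  normalization legitimate for large \<open>a\<close>.\<close>

lemma poisson_first_moment_sums: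
  fixes l :: real
  shows "(\<lambda>k. real k * (exp (- l) * l ^ k / fact k)) sums l"
proof -
  have "(\<lambda>k. (exp (- l) * l) * (l ^ k /\<^sub>R fact k)) sums ((exp (- l) * l) * exp l)"
    by (intro sums_mult exp_converges)
  moreover have "(exp (- l) * l) * exp l = l"
    by (simp add: exp_minus)
  moreover have "(exp (- l) * l) * (l ^ k /\<^sub>R fact k) = real (Suc k) * (exp (- l) * l ^ Suc k / fact (Suc k))" for k
    by (simp add: field_simps del: of_nat_Suc)
  ultimately have "(\<lambda>k. real (Suc k) * (exp (- l) * l ^ Suc k / fact (Suc k))) sums l"
    by simp
  then show ?thesis
    by (subst (asm) sums_Suc_iff) simp
qed

text \<open>With \<open>p k\<close> the Poisson weight, \<open>(k+1) * p (k+1) = l * p k\<close>.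
  One more factor \<open>k+1\<close> turns the second moment into \<open>l\<close> times the first
  moment plus \<open>l\<close> times the total mass; the term at 0 vanishes, so the index shift is
  free.\<close>

lemma poisson_second_moment_sums:
  fixes l :: real
  shows "(\<lambda>k. (real k)\<^sup>2 * (exp (- l) * l ^ k / fact k)) sums (l\<^sup>2 + l)"
proof -
  have "(\<lambda>k. l * (real k * (exp (- l) * l ^ k / fact k)) + l * (exp (- l) * (l ^ k /\<^sub>R fact k)))
      sums (l * l + l * (exp (- l) * exp l))"
    by (intro sums_add sums_mult poisson_first_moment_sums exp_converges)
  moreover have "l * (real k * (exp (- l) * l ^ k / fact k)) + l * (exp (- l) * (l ^ k /\<^sub>R fact k))
      = (real (Suc k))\<^sup>2 * (exp (- l) * l ^ Suc k / fact (Suc k))" for k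
  proof -
    have "(real (Suc k))\<^sup>2 * (exp (- l) * l ^ Suc k / fact (Suc k))
        = real (Suc k) * (exp (- l) * l ^ Suc k / fact k)"
      by (simp add: power2_eq_square del: of_nat_Suc)
    then show ?thesis
      by (simp add: field_simps)
  qed
  moreover have "l * l + l * (exp (- l) * exp l) = l\<^sup>2 + l"
    by (simp add: exp_minus power2_eq_square)
  ultimately have "(\<lambda>k. (real (Suc k))\<^sup>2 * (exp (- l) * l ^ Suc k / fact (Suc k))) sums (l\<^sup>2 + l)"
    by simp
  then show ?thesis
    by (subst (asm) sums_Suc_iff) simp
qed

lemma suminf_ennreal_sums:
  assumes "f sums l" and "\<And>k. 0 \<le> f k"
  shows "(\<Sum>k. ennreal (f k)) = ennreal l"
  using assms by (metis suminf_ennreal2 sums_iff)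

section \<open>Moment formulas for a Poisson random measure\<close>

locale prm =
  fixes M :: "'w measure" and N :: "'w \<Rightarrow> 'b measure" and nu :: "'b measure"
  assumes prm: "poisson_random_measure M N nu"
begin

sublocale prob_space M
  using prm by (simp add: poisson_random_measure_def)

lemma sets_N: "w \<in> space M \<Longrightarrow> sets (N w) = sets nu"
  using prm by (simp add: poisson_random_measure_def)

lemma measurable_emeasure_N [measurable]:
  "B \<in> sets nu \<Longrightarrow> (\<lambda>w. emeasure (N w) B) \<in> borel_measurable M"
  using prm by (simp add: poisson_random_measure_def)

lemma poisson_law:
  assumes "B \<in> sets nu" "emeasure nu B < \<infinity>"
  shows "prob {w\<in>space M. emeasure (N w) B = of_nat k}
    = exp (- enn2real (emeasure nu B)) * enn2real (emeasure nu B) ^ k / fact k"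
  using prm assms unfolding poisson_random_measure_def by blast

lemma emeasure_N_top:
  assumes "B \<in> sets nu" "emeasure nu B = \<infinity>"
  shows "AE w in M. emeasure (N w) B = \<infinity>"
  using prm assms unfolding poisson_random_measure_def by blast

lemma indep_emeasure_N:
  assumes "A \<in> sets nu" "B \<in> sets nu" "A \<inter> B = {}"
  shows "(\<integral>\<^sup>+w. emeasure (N w) A * emeasure (N w) B \<partial>M)
    = (\<integral>\<^sup>+w. emeasure (N w) A \<partial>M) * (\<integral>\<^sup>+w. emeasure (N w) B \<partial>M)"
proof -
  let ?B = "\<lambda>i::nat. if i = 0 then A else B"
  have "(\<forall>i<2. ?B i \<in> sets nu) \<and> disjoint_family_on ?B {..<2}"
    using assms by (auto simp: disjoint_family_on_def)
  then have "indep_vars (\<lambda>_. borel) (\<lambda>i w. emeasure (N w) (?B i)) {..<2}"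
    using prm[unfolded poisson_random_measure_def, THEN conjunct2, THEN conjunct2, THEN conjunct2,
      rule_format, of 2 ?B] by blast
  then have "(\<integral>\<^sup>+w. (\<Prod>i<2. emeasure (N w) (?B i)) \<partial>M) = (\<Prod>i<2. \<integral>\<^sup>+w. emeasure (N w) (?B i) \<partial>M)"
    by (intro indep_vars_nn_integral) auto
  then show ?thesis
    by (simp add: numeral_2_eq_2)
qed

text \<open>The Poisson weights sum to 1, so almost surely the count is a natural number and
  \<open>\<phi>\<close> of it is a countable sum of multiples of indicators. This is why
  \<open>\<phi>\<close> may be arbitrary.\<close>

lemma nn_integral_poisson:
  fixes \<phi> :: "ennreal \<Rightarrow> ennreal"
  assumes B [measurable]: "B \<in> sets nu" and fin: "emeasure nu B < \<infinity>"
  defines "l \<equiv> enn2real (emeasure nu B)"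
  shows "(\<integral>\<^sup>+w. \<phi> (emeasure (N w) B) \<partial>M)
    = (\<Sum>k. \<phi> (of_nat k) * ennreal (exp (- l) * l ^ k / fact k))"
proof -
  let ?E = "\<lambda>k::nat. {w\<in>space M. emeasure (N w) B = of_nat k}"
  have disj: "disjoint_family ?E"
    by (auto simp: disjoint_family_on_def)
  have "(\<lambda>k. exp (- l) * (l ^ k /\<^sub>R fact k)) sums (exp (- l) * exp l)"
    by (intro sums_mult exp_converges)
  moreover have "exp (- l) * (l ^ k /\<^sub>R fact k) = prob (?E k)" for k
    unfolding poisson_law[OF B fin] l_def by (simp add: divide_inverse mult.assoc mult.commute)
  moreover have "exp (- l) * exp l = 1"
    by (simp add: exp_minus)
  ultimately have "(\<lambda>k. prob (?E k)) sums 1"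
    by simp
  moreover have "(\<lambda>k. prob (?E k)) sums prob (\<Union>k. ?E k)"
    using disj by (intro finite_measure_UNION) auto
  ultimately have "prob (\<Union>k. ?E k) = 1"
    using sums_unique2 by blast
  then have AE: "AE w in M. w \<in> (\<Union>k. ?E k)"
    by (subst prob_eq_1[symmetric]) auto
  have "(\<integral>\<^sup>+w. \<phi> (emeasure (N w) B) \<partial>M) = (\<integral>\<^sup>+w. (\<Sum>k. \<phi> (of_nat k) * indicator (?E k) w) \<partial>M)"
  proof (rule nn_integral_cong_AE, use AE in eventually_elim)
    case (elim w)
    then obtain j :: nat where j: "w \<in> space M" "emeasure (N w) B = of_nat j"
      by auto
    then have "(\<Sum>k. \<phi> (of_nat k) * indicator (?E k) w) = (\<Sum>k\<in>{j}. \<phi> (of_nat k) * indicator (?E k) w)"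
      by (intro suminf_finite) (auto split: split_indicator)
    with j show ?case
      by simp
  qed
  also have "\<dots> = (\<Sum>k. \<integral>\<^sup>+w. \<phi> (of_nat k) * indicator (?E k) w \<partial>M)"
    by (intro nn_integral_suminf) auto
  also have "\<dots> = (\<Sum>k. \<phi> (of_nat k) * ennreal (exp (- l) * l ^ k / fact k))"
    using poisson_law[OF B fin] by (simp add: nn_integral_cmult emeasure_eq_measure l_def)
  finally show ?thesis .
qed

lemma nn_integral_emeasure_N:
  assumes B [measurable]: "B \<in> sets nu"
  shows "(\<integral>\<^sup>+w. emeasure (N w) B \<partial>M) = emeasure nu B"
proof (cases "emeasure nu B = \<infinity>")
  case True
  then show ?thesis
    using nn_integral_cong_AE[OF emeasure_N_top[OF B True]] by (simp add: emeasure_space_1)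
next
  case False
  define l where "l = enn2real (emeasure nu B)"
  have "(\<integral>\<^sup>+w. emeasure (N w) B \<partial>M) = (\<Sum>k. of_nat k * ennreal (exp (- l) * l ^ k / fact k))"
    using nn_integral_poisson[OF B, of "\<lambda>x. x"] False by (simp add: l_def top.not_eq_extremum)
  also have "\<dots> = (\<Sum>k. ennreal (real k * (exp (- l) * l ^ k / fact k)))"
    by (simp only: ennreal_mult'[OF of_nat_0_le_iff] ennreal_of_nat_eq_real_of_nat)
  also have "\<dots> = ennreal l"
    by (intro suminf_ennreal_sums poisson_first_moment_sums) (simp add: l_def)
  finally show ?thesis
    using False by (simp add: l_def top.not_eq_extremum)
qed

text \<open>From \<open>1 - exp (- x) \<le> x\<close>. It turns summable means into summable
  probabilities for the Borel-Cantelli argument on large jumps.\<close>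

lemma prob_emeasure_N_nonzero_le:
  assumes B [measurable]: "B \<in> sets nu" and fin: "emeasure nu B < \<infinity>"
  shows "prob {w\<in>space M. emeasure (N w) B \<noteq> 0} \<le> enn2real (emeasure nu B)"
proof -
  have "{w\<in>space M. emeasure (N w) B \<noteq> 0} = space M - {w\<in>space M. emeasure (N w) B = of_nat 0}"
    by auto
  then have "prob {w\<in>space M. emeasure (N w) B \<noteq> 0} = 1 - exp (- enn2real (emeasure nu B))"
    using poisson_law[OF B fin, of 0] by (simp add: prob_compl)
  also have "\<dots> \<le> enn2real (emeasure nu B)"
    using exp_ge_add_one_self[of "- enn2real (emeasure nu B)"] by simp
  finally show ?thesis .
qed

lemma nn_integral_emeasure_N_square:
  assumes B [measurable]: "B \<in> sets nu" and fin: "emeasure nu B < \<infinity>"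
  shows "(\<integral>\<^sup>+w. emeasure (N w) B * emeasure (N w) B \<partial>M)
    = emeasure nu B * emeasure nu B + emeasure nu B"
proof -
  define l where "l = enn2real (emeasure nu B)"
  have l: "emeasure nu B = ennreal l" "0 \<le> l"
    using fin by (simp_all add: l_def)
  have "(\<integral>\<^sup>+w. emeasure (N w) B * emeasure (N w) B \<partial>M)
      = (\<Sum>k. (of_nat k * of_nat k) * ennreal (exp (- l) * l ^ k / fact k))"
    using nn_integral_poisson[OF B fin, of "\<lambda>x. x * x"] by (simp add: l_def)
  also have "\<dots> = (\<Sum>k. ennreal ((real k)\<^sup>2 * (exp (- l) * l ^ k / fact k)))"
    by (simp only: ennreal_mult' of_nat_0_le_iff zero_le_power2 power2_eq_square zero_le_square
        ennreal_of_nat_eq_real_of_nat)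
  also have "\<dots> = ennreal (l\<^sup>2 + l)"
    by (intro suminf_ennreal_sums poisson_second_moment_sums) (simp add: l)
  finally show ?thesis
    by (simp add: l power2_eq_square ennreal_mult)
qed

text \<open>Counts on the disjoint pieces \<open>A - B\<close>, \<open>B - A\<close> and
  \<open>A \<inter> B\<close> are independent, so products of different pieces factor; the square of
  the count on \<open>A \<inter> B\<close> leaves the extra term, its Poisson variance.\<close>

lemma nn_integral_emeasure_N_mult:
  assumes A [measurable]: "A \<in> sets nu" and B [measurable]: "B \<in> sets nu"
  shows "(\<integral>\<^sup>+w. emeasure (N w) A * emeasure (N w) B \<partial>M)
    = emeasure nu A * emeasure nu B + emeasure nu (A \<inter> B)"
proof -
  \<comment> \<open>An infinite mean makes the count almost surely infinite. By the convention
    \<open>\<infinity> * 0 = 0\<close>, both sides are 0 if \<open>D\<close> is null and infinite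
    otherwise.\<close>
  have inf: "(\<integral>\<^sup>+w. emeasure (N w) C * emeasure (N w) D \<partial>M)
      = emeasure nu C * emeasure nu D + emeasure nu (C \<inter> D)"
    if [measurable]: "C \<in> sets nu" "D \<in> sets nu" and top: "emeasure nu C = \<infinity>" for C D
  proof -
    have "(\<integral>\<^sup>+w. emeasure (N w) C * emeasure (N w) D \<partial>M) = (\<integral>\<^sup>+w. \<infinity> * emeasure (N w) D \<partial>M)"
      using emeasure_N_top[OF that(1) top] by (intro nn_integral_cong_AE) auto
    also have "\<dots> = \<infinity> * emeasure nu D"
      by (simp add: nn_integral_cmult nn_integral_emeasure_N)
    finally show ?thesis
      using top emeasure_mono[of "C \<inter> D" D nu]
      by (cases "emeasure nu D = 0") (auto simp: ennreal_top_mult)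
  qed
  consider "emeasure nu A = \<infinity>" | "emeasure nu B = \<infinity>" | "emeasure nu A < \<infinity>" "emeasure nu B < \<infinity>"
    by (metis infinity_ennreal_def top.not_eq_extremum)
  then show ?thesis
  proof cases
    case 1
    then show ?thesis using inf[OF A B] by simp
  next
    case 2
    then show ?thesis using inf[OF B A] by (simp add: mult.commute Int_commute)
  next
    case 3
    define a b c where "a w = emeasure (N w) (A - B)" and "b w = emeasure (N w) (B - A)"
      and "c w = emeasure (N w) (A \<inter> B)" for w
    have [measurable]: "a \<in> borel_measurable M" "b \<in> borel_measurable M" "c \<in> borel_measurable M"
      by (auto simp: a_def[abs_def] b_def[abs_def] c_def[abs_def])
    \<comment> \<open>Stated for every measure on these sets, since it is applied both to each
      \<open>N w\<close> and to the mean measure.\<close>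
    have split: "emeasure m A = emeasure m (A - B) + emeasure m (A \<inter> B)"
      "emeasure m B = emeasure m (B - A) + emeasure m (A \<inter> B)" if "sets m = sets nu" for m
    proof -
      have "A = (A - B) \<union> (A \<inter> B)" "B = (B - A) \<union> (A \<inter> B)"
        by auto
      moreover have "emeasure m ((A - B) \<union> (A \<inter> B)) = emeasure m (A - B) + emeasure m (A \<inter> B)"
          "emeasure m ((B - A) \<union> (A \<inter> B)) = emeasure m (B - A) + emeasure m (A \<inter> B)"
        using that by (intro plus_emeasure[symmetric]; auto)+
      ultimately show "emeasure m A = emeasure m (A - B) + emeasure m (A \<inter> B)"
        "emeasure m B = emeasure m (B - A) + emeasure m (A \<inter> B)" by metis+
    qed
    have ab: "(\<integral>\<^sup>+w. a w * b w \<partial>M) = emeasure nu (A - B) * emeasure nu (B - A)"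
      unfolding a_def b_def by (subst indep_emeasure_N) (auto simp: nn_integral_emeasure_N)
    have ac: "(\<integral>\<^sup>+w. a w * c w \<partial>M) = emeasure nu (A - B) * emeasure nu (A \<inter> B)"
      unfolding a_def c_def by (subst indep_emeasure_N) (auto simp: nn_integral_emeasure_N)
    have cb: "(\<integral>\<^sup>+w. c w * b w \<partial>M) = emeasure nu (A \<inter> B) * emeasure nu (B - A)"
      unfolding b_def c_def by (subst indep_emeasure_N) (auto simp: nn_integral_emeasure_N)
    have "emeasure nu (A \<inter> B) < \<infinity>"
      using 3 emeasure_mono[of "A \<inter> B" A nu] by (auto intro: le_less_trans)
    then have cc: "(\<integral>\<^sup>+w. c w * c w \<partial>M)
        = emeasure nu (A \<inter> B) * emeasure nu (A \<inter> B) + emeasure nu (A \<inter> B)"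
      unfolding c_def by (subst nn_integral_emeasure_N_square) auto
    have "(\<integral>\<^sup>+w. emeasure (N w) A * emeasure (N w) B \<partial>M)
        = (\<integral>\<^sup>+w. a w * b w + a w * c w + (c w * b w + c w * c w) \<partial>M)"
      by (intro nn_integral_cong)
        (simp add: split sets_N a_def b_def c_def distrib_left distrib_right ac_simps)
    also have "\<dots> = emeasure nu (A - B) * emeasure nu (B - A) + emeasure nu (A - B) * emeasure nu (A \<inter> B)
        + (emeasure nu (A \<inter> B) * emeasure nu (B - A)
        + (emeasure nu (A \<inter> B) * emeasure nu (A \<inter> B) + emeasure nu (A \<inter> B)))"
      by (simp add: nn_integral_add ab ac cb cc)
    also have "\<dots> = emeasure nu A * emeasure nu B + emeasure nu (A \<inter> B)"
      unfolding split[OF refl] by (simp add: distrib_left distrib_right ac_simps)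
    finally show ?thesis .
  qed
qed

lemma borel_measurable_N:
  "w \<in> space M \<Longrightarrow> g \<in> borel_measurable nu \<Longrightarrow> g \<in> borel_measurable (N w)"
  using measurable_cong_sets[OF sets_N refl] by blast

lemma measurable_nn_integral_N [measurable]:
  assumes g: "g \<in> borel_measurable nu"
  shows "(\<lambda>w. \<integral>\<^sup>+z. g z \<partial>N w) \<in> borel_measurable M"
  using g
proof (induction rule: borel_measurable_induct)
  case (cong f g)
  have "(\<integral>\<^sup>+z. f z \<partial>N w) = (\<integral>\<^sup>+z. g z \<partial>N w)" if "w \<in> space M" for w
    using cong(3) sets_eq_imp_space_eq[OF sets_N[OF that]] by (intro nn_integral_cong) auto
  then show ?case
    using cong(4) by (simp cong: measurable_cong)
next
  case (set A)
  then show ?case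
    by (simp add: sets_N cong: measurable_cong)
next
  case (mult u c)
  then show ?case
    by (simp add: nn_integral_cmult borel_measurable_N cong: measurable_cong)
next
  case (add u v)
  then show ?case
    by (simp add: nn_integral_add borel_measurable_N cong: measurable_cong)
next
  case (seq U)
  have "(\<integral>\<^sup>+z. (SUP i. U i) z \<partial>N w) = (SUP i. \<integral>\<^sup>+z. U i z \<partial>N w)" if "w \<in> space M" for w
    using seq that unfolding SUP_apply
    by (intro nn_integral_monotone_convergence_SUP) (auto intro: borel_measurable_N)
  then show ?case
    using seq by (simp cong: measurable_cong)
qed

text \<open>Taking \<^term>\<open>Z\<close> to be first a count \<open>N(A)\<close> and then an integral against \<open>N\<close>
  builds the bilinear second-moment formula one argument at a time.\<close>

lemma nn_integral_Campbell_gen: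
  fixes Z :: "'w \<Rightarrow> ennreal" and k :: "'b \<Rightarrow> ennreal"
  assumes g: "g \<in> borel_measurable nu"
    and Z [measurable]: "Z \<in> borel_measurable M"
    and k [measurable]: "k \<in> borel_measurable nu"
    and sets: "\<And>A. A \<in> sets nu \<Longrightarrow> (\<integral>\<^sup>+w. Z w * emeasure (N w) A \<partial>M)
       = c * emeasure nu A + (\<integral>\<^sup>+z. k z * indicator A z \<partial>nu)"
  shows "(\<integral>\<^sup>+w. Z w * (\<integral>\<^sup>+z. g z \<partial>N w) \<partial>M) = c * (\<integral>\<^sup>+z. g z \<partial>nu) + (\<integral>\<^sup>+z. k z * g z \<partial>nu)"
  using g
proof (induction rule: borel_measurable_induct)
  case (cong f g)
  have "(\<integral>\<^sup>+z. f z \<partial>N w) = (\<integral>\<^sup>+z. g z \<partial>N w)" if "w \<in> space M" for w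
    using cong(3) sets_eq_imp_space_eq[OF sets_N[OF that]] by (intro nn_integral_cong) auto
  then show ?case
    using cong(3,4) by (simp cong: nn_integral_cong)
next
  case (set A)
  then show ?case
    using sets[of A] by (simp add: sets_N cong: nn_integral_cong)
next
  case (mult u d)
  have "(\<integral>\<^sup>+w. Z w * (\<integral>\<^sup>+z. d * u z \<partial>N w) \<partial>M) = (\<integral>\<^sup>+w. d * (Z w * (\<integral>\<^sup>+z. u z \<partial>N w)) \<partial>M)"
    using mult by (intro nn_integral_cong) (simp add: nn_integral_cmult borel_measurable_N ac_simps)
  also have "\<dots> = d * (\<integral>\<^sup>+w. Z w * (\<integral>\<^sup>+z. u z \<partial>N w) \<partial>M)"
    using mult by (simp add: nn_integral_cmult)
  moreover have "(\<integral>\<^sup>+z. k z * (d * u z) \<partial>nu) = d * (\<integral>\<^sup>+z. k z * u z \<partial>nu)"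
    using mult by (subst nn_integral_cmult[symmetric]) (auto simp: ac_simps)
  ultimately show ?case
    using mult by (simp add: nn_integral_cmult distrib_left ac_simps)
next
  case (add u v)
  have "(\<integral>\<^sup>+w. Z w * (\<integral>\<^sup>+z. v z + u z \<partial>N w) \<partial>M)
      = (\<integral>\<^sup>+w. Z w * (\<integral>\<^sup>+z. v z \<partial>N w) + Z w * (\<integral>\<^sup>+z. u z \<partial>N w) \<partial>M)"
    using add by (intro nn_integral_cong) (simp add: nn_integral_add borel_measurable_N distrib_left)
  also have "\<dots> = (\<integral>\<^sup>+w. Z w * (\<integral>\<^sup>+z. v z \<partial>N w) \<partial>M) + (\<integral>\<^sup>+w. Z w * (\<integral>\<^sup>+z. u z \<partial>N w) \<partial>M)"
    using add by (intro nn_integral_add) auto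
  finally show ?case
    using add by (simp add: nn_integral_add distrib_left ac_simps)
next
  case (seq U)
  have "(\<integral>\<^sup>+w. Z w * (\<integral>\<^sup>+z. (SUP i. U i) z \<partial>N w) \<partial>M)
      = (\<integral>\<^sup>+w. (SUP i. Z w * (\<integral>\<^sup>+z. U i z \<partial>N w)) \<partial>M)"
  proof (intro nn_integral_cong)
    fix w assume "w \<in> space M"
    then have "(\<integral>\<^sup>+z. (SUP i. U i) z \<partial>N w) = (SUP i. \<integral>\<^sup>+z. U i z \<partial>N w)"
      using seq unfolding SUP_apply
      by (intro nn_integral_monotone_convergence_SUP) (auto intro: borel_measurable_N)
    then show "Z w * (\<integral>\<^sup>+z. (SUP i. U i) z \<partial>N w) = (SUP i. Z w * (\<integral>\<^sup>+z. U i z \<partial>N w))"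
      by (simp add: SUP_mult_left_ennreal)
  qed
  also have "\<dots> = (SUP i. \<integral>\<^sup>+w. Z w * (\<integral>\<^sup>+z. U i z \<partial>N w) \<partial>M)"
    using seq
    by (intro nn_integral_monotone_convergence_SUP)
      (auto simp: incseq_def le_fun_def intro!: mult_left_mono nn_integral_mono)
  also have "\<dots> = (SUP i. c * (\<integral>\<^sup>+z. U i z \<partial>nu) + (\<integral>\<^sup>+z. k z * U i z \<partial>nu))"
    using seq by simp
  also have "\<dots> = (SUP i. c * (\<integral>\<^sup>+z. U i z \<partial>nu)) + (SUP i. \<integral>\<^sup>+z. k z * U i z \<partial>nu)"
    using seq
    by (intro ennreal_SUP_add)
      (auto simp: incseq_def le_fun_def intro!: mult_left_mono nn_integral_mono)
  also have "(SUP i. c * (\<integral>\<^sup>+z. U i z \<partial>nu)) = c * (\<integral>\<^sup>+z. (SUP i. U i) z \<partial>nu)"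
    using seq unfolding SUP_apply
    by (subst nn_integral_monotone_convergence_SUP) (auto simp: SUP_mult_left_ennreal)
  also have "(SUP i. \<integral>\<^sup>+z. k z * U i z \<partial>nu) = (\<integral>\<^sup>+z. k z * (SUP i. U i) z \<partial>nu)"
    using seq unfolding SUP_apply SUP_mult_left_ennreal
    by (intro nn_integral_monotone_convergence_SUP[symmetric])
      (auto simp: incseq_def le_fun_def intro!: mult_left_mono)
  finally show ?case .
qed

lemma nn_integral_Campbell:
  assumes "g \<in> borel_measurable nu"
  shows "(\<integral>\<^sup>+w. (\<integral>\<^sup>+z. g z \<partial>N w) \<partial>M) = (\<integral>\<^sup>+z. g z \<partial>nu)"
  using nn_integral_Campbell_gen[of g "\<lambda>_. 1" "\<lambda>_. 0" 1] assms
  by (simp add: nn_integral_emeasure_N)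

lemma nn_integral_Campbell_mult:
  assumes g [measurable]: "g \<in> borel_measurable nu" and h [measurable]: "h \<in> borel_measurable nu"
  shows "(\<integral>\<^sup>+w. (\<integral>\<^sup>+z. g z \<partial>N w) * (\<integral>\<^sup>+z. h z \<partial>N w) \<partial>M)
    = (\<integral>\<^sup>+z. g z \<partial>nu) * (\<integral>\<^sup>+z. h z \<partial>nu) + (\<integral>\<^sup>+z. g z * h z \<partial>nu)"
proof (rule nn_integral_Campbell_gen)
  fix A assume A [measurable]: "A \<in> sets nu"
  \<comment> \<open>This inner application has \<open>Z = N(A)\<close>, with \<open>c\<close> the
    mean of \<open>A\<close> and \<open>k\<close> its indicator. The outer one takes the integral of
    \<open>g\<close> for \<open>Z\<close>, its mean for \<open>c\<close>, and \<open>g\<close>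
    itself for \<open>k\<close>.\<close>
  have "(\<integral>\<^sup>+w. emeasure (N w) A * (\<integral>\<^sup>+z. g z \<partial>N w) \<partial>M)
      = emeasure nu A * (\<integral>\<^sup>+z. g z \<partial>nu) + (\<integral>\<^sup>+z. indicator A z * g z \<partial>nu)"
    by (rule nn_integral_Campbell_gen)
      (auto simp: nn_integral_emeasure_N_mult nn_integral_indicator[symmetric] indicator_inter_arith
        simp del: nn_integral_indicator)
  then show "(\<integral>\<^sup>+w. (\<integral>\<^sup>+z. g z \<partial>N w) * emeasure (N w) A \<partial>M)
      = (\<integral>\<^sup>+z. g z \<partial>nu) * emeasure nu A + (\<integral>\<^sup>+z. g z * indicator A z \<partial>nu)"
    by (simp add: mult.commute)
qed auto

end

section \<open>Geometric estimates, interpolation and variance\<close>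

text \<open>A geometric sum is at most \<open>b / (b - 1)\<close> times its last term, and here that
  term is less than \<open>s\<close>. Linearity of the bound in \<open>s\<close> lets the first
  moment of \<open>rho\<close> control the large jumps.\<close>

lemma sum_powers_below_le:
  fixes b s :: real
  assumes b: "1 < b" and s: "0 \<le> s"
  shows "(\<Sum>k<n. b ^ k * indicator {b ^ k<..} s) \<le> b / (b - 1) * s"
proof (induction n)
  case 0
  then show ?case using assms by simp
next
  case (Suc n)
  show ?case
  proof (cases "b ^ n < s")
    case True
    have "(\<Sum>k<Suc n. b ^ k * indicator {b ^ k<..} s) \<le> (\<Sum>k<Suc n. b ^ k)"
      using b by (intro sum_mono) (auto split: split_indicator)
    also have "\<dots> = (b ^ Suc n - 1) / (b - 1)"
      using b by (subst geometric_sum) auto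
    also have "\<dots> \<le> b * b ^ n / (b - 1)"
      using b by (intro divide_right_mono) auto
    also have "\<dots> \<le> b * s / (b - 1)"
      using b True by (intro divide_right_mono mult_left_mono) auto
    finally show ?thesis by simp
  next
    case False
    then show ?thesis using Suc by simp
  qed
qed

text \<open>At the first exponent with \<open>s \<le> b ^ j\<close> the term is at most 1, and from
  there on the terms decay with ratio \<open>1 / b\<close>. Times \<open>s\<close>, this bounds the
  sum of \<open>s\<^sup>2 / b ^ k\<close> over \<open>b ^ k \<ge> s\<close> by a multiple of
  \<open>s\<close>, as the truncated variances require.\<close>

lemma sum_inverse_powers_above_le:
  fixes b s :: real
  assumes b: "1 < b" and s: "0 \<le> s"
  shows "(\<Sum>k<n. s / b ^ k * indicator {..b ^ k} s) \<le> b / (b - 1)"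
proof -
  \<comment> \<open>The start index is generalized for a downward induction: while
    \<open>b ^ j < s\<close> the new term vanishes; otherwise the whole tail is compared directly
    with the full geometric series.\<close>
  have "(\<Sum>k=j..<n. s / b ^ k * indicator {..b ^ k} s) \<le> b / (b - 1)" if "j \<le> n" for j
    using that
  proof (induction rule: inc_induct)
    case base
    then show ?case using b by simp
  next
    case (step j)
    show ?case
    proof (cases "s \<le> b ^ j")
      case True
      have geo: "(\<Sum>k<n - j. (1 / b) ^ k) \<le> b / (b - 1)"
      proof -
        have "(\<Sum>k<n - j. (1 / b) ^ k) \<le> (\<Sum>k. (1 / b) ^ k)"
          using b by (intro sum_le_suminf) (auto intro!: summable_geometric)
        also have "\<dots> = b / (b - 1)"
          using b by (subst suminf_geometric) (auto simp: field_simps)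
        finally show ?thesis .
      qed
      have "(\<Sum>k=j..<n. s / b ^ k * indicator {..b ^ k} s) \<le> (\<Sum>k=j..<n. s / b ^ k)"
        using b s by (intro sum_mono) (auto split: split_indicator)
      also have "\<dots> = s / b ^ j * (\<Sum>k<n - j. (1 / b) ^ k)"
        using step.hyps sum.shift_bounds_nat_ivl[of "\<lambda>k. s / b ^ k" 0 j "n - j"]
        by (simp add: sum_distrib_left power_add atLeast0LessThan power_divide mult.commute)
      also have "\<dots> \<le> 1 * (b / (b - 1))"
        using b s True geo by (intro mult_mono sum_nonneg) auto
      finally show ?thesis by simp
    next
      case False
      then show ?thesis
        using step by (simp add: sum.atLeast_Suc_lessThan)
    qed
  qed
  from this[of 0] show ?thesis
    by (simp add: atLeast0LessThan)
qed

lemma suminf_ennreal_le: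
  assumes "\<And>k. 0 \<le> f k" and "\<And>n. (\<Sum>k<n. f k) \<le> C"
  shows "(\<Sum>k. ennreal (f k)) \<le> ennreal C"
  using assms by (intro suminf_le_const) (auto simp: ennreal_leI)

text \<open>Monotonicity in the parameter upgrades convergence along all geometric sequences to
  convergence along the reals; this is the last step of Etemadi's argument.\<close>

lemma tendsto_div_self_of_geometric:
  fixes F :: "real \<Rightarrow> real" and L :: real
  assumes mono: "\<And>x y. x \<le> y \<Longrightarrow> F x \<le> F y" and nonneg: "\<And>x. 0 \<le> F x"
    and lim: "\<And>j::nat. (\<lambda>k. F ((1 + 1 / Suc j) ^ k) / (1 + 1 / Suc j) ^ k) \<longlonglongrightarrow> L"
  shows "((\<lambda>a. F a / a) \<longlongrightarrow> L) at_top"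
proof -
  have sandwich: "\<forall>\<^sub>F a in at_top. \<exists>k\<ge>K. b ^ k \<le> a \<and> a < b ^ Suc k" if b: "1 < b" for b :: real and K
    using eventually_ge_at_top[of "b ^ K"]
  proof eventually_elim
    case (elim a)
    obtain n0 where "a < b ^ n0"
      using real_arch_pow[OF b] by blast
    \<comment> \<open>The least exponent beyond \<open>a\<close> exceeds \<open>K\<close> because
      \<open>b ^ K \<le> a\<close>; its predecessor is the required \<open>k\<close>.\<close>
    define n where "n = (LEAST n. a < b ^ n)"
    have n: "a < b ^ n"
      unfolding n_def using \<open>a < b ^ n0\<close> by (rule LeastI)
    then have "b ^ K < b ^ n"
      using elim by linarith
    then have "K < n"
      using b power_less_imp_less_exp by blast
    then obtain k where k: "n = Suc k" "K \<le> k"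
      by (cases n) auto
    have "\<not> a < b ^ k"
      using not_less_Least[of k "\<lambda>n. a < b ^ n"] k n_def by auto
    then show ?case
      using k n by (intro exI[of _ k]) auto
  qed
  \<comment> \<open>Replacing \<open>a\<close> by a neighbouring power costs a factor at most
    \<open>b\<close>. As the ratios tend to 1, a strict inequality between \<open>c\<close> and
    \<open>L\<close> survives this factor for a suitable \<open>j\<close>; arguing by limits covers
    negative \<open>c\<close> as well.\<close>
  have seq: "(\<lambda>j::nat. (1 + 1 / real (Suc j)) * c) \<longlonglongrightarrow> c" for c :: real
    using tendsto_mult[OF tendsto_add[OF tendsto_const[of 1] LIMSEQ_Suc[OF lim_1_over_n]]
      tendsto_const[of c]] by (simp add: inverse_eq_divide)
  show ?thesis
  proof (rule order_tendstoI)
    fix c assume c: "L < c"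
    from order_tendstoD(2)[OF seq c] obtain j where j: "(1 + 1 / real (Suc j)) * L < c"
      by (meson eventually_sequentially le_refl)
    define b where "b = 1 + 1 / real (Suc j)"
    have b: "1 < b"
      by (simp add: b_def)
    have "L < c / b"
      using j[folded b_def] b by (simp add: field_simps)
    from order_tendstoD(2)[OF lim this, of j] obtain K where
      K: "\<And>k. K \<le> k \<Longrightarrow> F (b ^ k) / b ^ k < c / b"
      unfolding b_def by (auto simp: eventually_sequentially)
    from sandwich[OF b, of K] show "\<forall>\<^sub>F a in at_top. F a / a < c"
    proof eventually_elim
      case (elim a)
      then obtain k where k: "K \<le> k" "b ^ k \<le> a" "a < b ^ Suc k"
        by blast
      have "F a / a \<le> F (b ^ Suc k) / b ^ k"
        using k b nonneg by (intro frac_le mono) auto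
      also have "\<dots> = b * (F (b ^ Suc k) / b ^ Suc k)"
        using b by simp
      also have "\<dots> < b * (c / b)"
        using K[of "Suc k"] k b by (intro mult_strict_left_mono) auto
      finally show ?case
        using b by simp
    qed
  next
    fix c assume c: "c < L"
    from order_tendstoD(2)[OF seq c] obtain j where j: "(1 + 1 / real (Suc j)) * c < L"
      by (meson eventually_sequentially le_refl)
    define b where "b = 1 + 1 / real (Suc j)"
    have b: "1 < b"
      by (simp add: b_def)
    from order_tendstoD(1)[OF lim j[folded b_def], of j] obtain K where
      K: "\<And>k. K \<le> k \<Longrightarrow> b * c < F (b ^ k) / b ^ k"
      unfolding b_def by (auto simp: eventually_sequentially)
    from sandwich[OF b, of K] show "\<forall>\<^sub>F a in at_top. c < F a / a"
    proof eventually_elim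
      case (elim a)
      then obtain k where k: "K \<le> k" "b ^ k \<le> a" "a < b ^ Suc k"
        by blast
      have pos: "0 < b ^ k" using b by simp
      have "c = b * c / b"
        using b by simp
      also have "\<dots> < (F (b ^ k) / b ^ k) / b"
        using K[of k] k b by (intro divide_strict_right_mono) auto
      also have "\<dots> = F (b ^ k) / b ^ Suc k"
        by (simp add: field_simps)
      also have "\<dots> \<le> F a / a"
        using k b nonneg less_le_trans[OF pos k(2)] by (intro frac_le mono) auto
      finally show ?case .
    qed
  qed
qed

text \<open>The second moment is given as \<open>e * e + v\<close>, the form in which Campbell's
  formula delivers it, so the variance is read off without subtraction in \<open>ennreal\<close>.
  Finiteness of \<open>e\<close> makes \<open>T\<close> almost surely finite, which justifies
  passing to \<open>enn2real\<close>.\<close>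

lemma (in prob_space) nn_integral_variance:
  fixes T :: "'a \<Rightarrow> ennreal" and e v :: ennreal
  assumes T [measurable]: "T \<in> borel_measurable M"
    and e: "(\<integral>\<^sup>+w. T w \<partial>M) = e" and v: "(\<integral>\<^sup>+w. T w * T w \<partial>M) = e * e + v"
    and fin: "e < \<infinity>" "v < \<infinity>"
  shows "(\<integral>\<^sup>+w. ennreal ((enn2real (T w) - enn2real e)\<^sup>2) \<partial>M) = v"
proof -
  define X where "X w = enn2real (T w)" for w
  have X [measurable]: "X \<in> borel_measurable M"
    by (simp add: X_def[abs_def])
  have "AE w in M. T w \<noteq> \<infinity>"
    using e fin by (intro nn_integral_PInf_AE) auto
  then have AE: "AE w in M. ennreal (X w) = T w"
    by eventually_elim (auto simp: X_def top.not_eq_extremum)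
  have eX: "(\<integral>\<^sup>+w. ennreal (X w) \<partial>M) = e"
    unfolding e[symmetric] by (intro nn_integral_cong_AE AE)
  have "(\<integral>\<^sup>+w. ennreal ((X w)\<^sup>2) \<partial>M) = (\<integral>\<^sup>+w. T w * T w \<partial>M)"
  proof (rule nn_integral_cong_AE, use AE in eventually_elim)
    case (elim w)
    have "ennreal ((X w)\<^sup>2) = ennreal (X w) * ennreal (X w)"
      by (simp add: power2_eq_square ennreal_mult X_def)
    then show ?case using elim by simp
  qed
  then have vX: "(\<integral>\<^sup>+w. ennreal ((X w)\<^sup>2) \<partial>M) = e * e + v"
    by (simp add: v)
  have int: "integrable M X" "integrable M (\<lambda>w. (X w)\<^sup>2)"
    using fin eX vX by (auto intro!: integrableI_bounded simp: X_def ennreal_mult_less_top)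
  have "expectation X = enn2real e"
    using eX by (subst integral_eq_nn_integral) (auto simp: X_def)
  moreover have "expectation (\<lambda>w. (X w)\<^sup>2) = (enn2real e)\<^sup>2 + enn2real v"
    using vX fin
    by (subst integral_eq_nn_integral)
      (auto simp: enn2real_plus enn2real_mult power2_eq_square ennreal_mult_less_top)
  ultimately have "expectation (\<lambda>w. (X w - enn2real e)\<^sup>2) = enn2real v"
    using variance_eq[OF int] by simp
  moreover have "integrable M (\<lambda>w. (X w - enn2real e)\<^sup>2)"
    using int by (auto simp: power2_diff)
  ultimately have "(\<integral>\<^sup>+w. ennreal ((X w - enn2real e)\<^sup>2) \<partial>M) = ennreal (enn2real v)"
    by (subst nn_integral_eq_integral) auto
  then show ?thesis
    using fin by (simp add: X_def)
qed

section \<open>The Levy setting and the strong law along geometric sequences\<close>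

locale levy_prm =
  fixes M :: "'w measure"
    and N :: "'w \<Rightarrow> (real \<times> real \<times> 'x::topological_space) measure"
    and rho :: "real measure"
    and H :: "'x measure"
  assumes rho_sets [measurable_cong]: "sets rho = sets borel"
    and rho_supp: "emeasure rho {..0} = 0"
    and rho_levy: "(\<integral>\<^sup>+ s. ennreal (min s 1) \<partial>rho) < \<infinity>"
    and rho_inf: "emeasure rho {0<..} = \<infinity>"
    and tau1: "(\<integral>\<^sup>+ s. ennreal s * indicator {1..} s \<partial>rho) < \<infinity>"
    and H_prob: "prob_space H"
    and H_sets [measurable_cong]: "sets H = sets borel"
    and N_prm: "poisson_random_measure M N (mean_measure rho H)"
begin

sublocale prm M N "mean_measure rho H"
  using N_prm by unfold_locales

sublocale H: prob_space H
  by (rule H_prob)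

text \<open>\<open>ennreal s\<close> is 0 for negative \<open>s\<close>, so this is the first moment
  over the positive axis. It turns out to be the almost sure growth rate of the total mass in
  \<open>a\<close>.\<close>

definition jump_mean :: ennreal where
  "jump_mean = (\<integral>\<^sup>+s. ennreal s \<partial>rho)"

lemma jump_mean_finite: "jump_mean < \<infinity>"
proof -
  have "jump_mean \<le> (\<integral>\<^sup>+s. ennreal (min s 1) + ennreal s * indicator {1..} s \<partial>rho)"
    unfolding jump_mean_def by (intro nn_integral_mono) (auto split: split_indicator simp: min_def)
  also have "\<dots> = (\<integral>\<^sup>+s. ennreal (min s 1) \<partial>rho) + (\<integral>\<^sup>+s. ennreal s * indicator {1..} s \<partial>rho)"
    by (intro nn_integral_add) auto
  also have "\<dots> < \<infinity>"
    using rho_levy tau1 by simp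
  finally show ?thesis .
qed

text \<open>A vanishing first moment would leave no mass on the positive axis, against
  \<open>rho_inf\<close>. Later this keeps the limiting denominator of the normalization away from
  0.\<close>

lemma jump_mean_pos: "0 < jump_mean"
proof (rule ccontr)
  assume "\<not> 0 < jump_mean"
  then have "(\<integral>\<^sup>+s. ennreal s \<partial>rho) = 0"
    by (simp add: jump_mean_def)
  then have "AE s in rho. ennreal s = 0"
    by (subst (asm) nn_integral_0_iff_AE) auto
  then have "AE s in rho. s \<notin> {0<..}"
    by eventually_elim (auto simp: ennreal_eq_0_iff)
  then have "emeasure rho {0<..} = 0"
    by (subst (asm) AE_iff_measurable[of "{0<..}"]) (auto simp: rho_sets sets_eq_imp_space_eq[OF rho_sets])
  then show False
    using rho_inf by simp
qed

lemma AE_rho_pos: "AE s in rho. 0 < s"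
  by (rule AE_I[of _ _ "{..0}"]) (auto simp: rho_supp rho_sets not_less)

lemma rho_greaterThan_finite:
  assumes "0 < c"
  shows "emeasure rho {c<..} < \<infinity>"
proof -
  have "emeasure rho {c<..} = (\<integral>\<^sup>+s. indicator {c<..} s \<partial>rho)"
    by (simp add: rho_sets)
  also have "\<dots> \<le> (\<integral>\<^sup>+s. ennreal (1 / c) * ennreal s \<partial>rho)"
    using assms by (intro nn_integral_mono)
      (auto simp: ennreal_mult'[symmetric] field_simps split: split_indicator)
  also have "\<dots> = ennreal (1 / c) * jump_mean"
    unfolding jump_mean_def by (intro nn_integral_cmult) auto
  also have "\<dots> < \<infinity>"
    using jump_mean_finite by (simp add: ennreal_mult_less_top)
  finally show ?thesis .
qed

text \<open>\<open>rho\<close> is infinite with its mass accumulating at 0, but finite away from 0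
  by Markov's inequality. Tonelli's theorem for \<open>mean_measure\<close> rests on this.\<close>

lemma sigma_finite_rho: "sigma_finite_measure rho"
proof
  let ?A = "insert {..0} (range (\<lambda>n::nat. {1 / real (Suc n)<..}))"
  have "\<exists>n::nat. 1 / real (Suc n) < s" if "0 < s" for s :: real
    using nat_approx_posE[OF that] by blast
  then have "\<Union>?A = UNIV"
    by (force simp: not_le)
  moreover have "emeasure rho a \<noteq> \<infinity>" if "a \<in> ?A" for a
    using that rho_supp rho_greaterThan_finite[of "1 / real (Suc n)" for n]
    by (auto simp: less_top[symmetric] simp del: of_nat_Suc)
  ultimately show "\<exists>A. countable A \<and> A \<subseteq> sets rho \<and> \<Union> A = space rho \<and> (\<forall>a\<in>A. emeasure rho a \<noteq> \<infinity>)"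
    by (intro exI[of _ ?A]) (auto simp: rho_sets sets_eq_imp_space_eq[OF rho_sets])
qed

lemma sets_mean_measure [measurable_cong]:
  "sets (mean_measure rho H) = sets (borel \<Otimes>\<^sub>M (borel \<Otimes>\<^sub>M borel))"
  unfolding mean_measure_def
  by (simp cong: sets_pair_measure_cong add: rho_sets H_sets)

text \<open>Tonelli separates time, size and location. The restriction to positive sizes disappears
  because \<open>rho\<close> gives no mass to \<open>{..0}\<close>; the one to nonnegative times
  stays and is later absorbed by \<open>{0..a}\<close>.\<close>

lemma nn_integral_mean_measure:
  fixes u v :: "real \<Rightarrow> ennreal" and g :: "'x \<Rightarrow> ennreal"
  assumes [measurable]: "u \<in> borel_measurable borel" "v \<in> borel_measurable borel"
    "g \<in> borel_measurable borel"
  shows "(\<integral>\<^sup>+z. v (fst (snd z)) * u (fst z) * g (snd (snd z)) \<partial>mean_measure rho H)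
    = (\<integral>\<^sup>+t. u t * indicator {0..} t \<partial>lborel) * ((\<integral>\<^sup>+s. v s \<partial>rho) * (\<integral>\<^sup>+x. g x \<partial>H))"
proof -
  interpret rho: sigma_finite_measure rho
    by (rule sigma_finite_rho)
  interpret RH: pair_sigma_finite rho H ..
  have [measurable]: "({0..} \<times> {0<..} \<times> UNIV :: (real \<times> real \<times> 'x) set)
      \<in> sets (lborel \<Otimes>\<^sub>M (rho \<Otimes>\<^sub>M H))"
    using sets_eq_imp_space_eq[OF H_sets] by (intro pair_measureI) (auto simp: rho_sets H_sets)
  have "(\<integral>\<^sup>+z. v (fst (snd z)) * u (fst z) * g (snd (snd z)) \<partial>mean_measure rho H)
      = (\<integral>\<^sup>+z. (u (fst z) * indicator {0..} (fst z)) *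
          (v (fst (snd z)) * indicator {0<..} (fst (snd z)) * g (snd (snd z))) \<partial>(lborel \<Otimes>\<^sub>M (rho \<Otimes>\<^sub>M H)))"
    unfolding mean_measure_def
    by (subst nn_integral_density) (auto simp: indicator_def ac_simps intro!: nn_integral_cong)
  also have "\<dots> = (\<integral>\<^sup>+t. \<integral>\<^sup>+s. \<integral>\<^sup>+x. (u t * indicator {0..} t) * (v s * indicator {0<..} s * g x) \<partial>H \<partial>rho \<partial>lborel)"
    by (simp add: RH.P.nn_integral_fst[symmetric] H.nn_integral_fst[symmetric])
  also have "\<dots> = (\<integral>\<^sup>+t. u t * indicator {0..} t \<partial>lborel) *
      ((\<integral>\<^sup>+s. v s * indicator {0<..} s \<partial>rho) * (\<integral>\<^sup>+x. g x \<partial>H))"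
    by (simp add: nn_integral_cmult nn_integral_multc)
  also have "(\<integral>\<^sup>+s. v s * indicator {0<..} s \<partial>rho) = (\<integral>\<^sup>+s. v s \<partial>rho)"
    using AE_rho_pos by (intro nn_integral_cong_AE) auto
  finally show ?thesis .
qed

lemma nn_integral_mean_measure_strip:
  fixes v :: "real \<Rightarrow> ennreal" and g :: "'x \<Rightarrow> ennreal"
  assumes "v \<in> borel_measurable borel" "g \<in> borel_measurable borel" "0 \<le> a"
  shows "(\<integral>\<^sup>+z. v (fst (snd z)) * indicator {0..a} (fst z) * g (snd (snd z)) \<partial>mean_measure rho H)
    = ennreal a * ((\<integral>\<^sup>+s. v s \<partial>rho) * (\<integral>\<^sup>+x. g x \<partial>H))"
proof -
  have "(\<integral>\<^sup>+t. indicator {0..a} t * indicator {0..} t \<partial>lborel) = (\<integral>\<^sup>+t. indicator {0..a} t \<partial>lborel)"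
    by (intro nn_integral_cong) (auto split: split_indicator)
  then show ?thesis
    using assms by (subst nn_integral_mean_measure) auto
qed

text \<open>Written as an integral against \<open>N w\<close> so that Campbell's formulas apply;
  \<open>nn_integral_crm\<close> identifies it with the integral of \<open>g\<close> against
  \<open>crm N a w\<close>.\<close>

definition crm_integral :: "('x \<Rightarrow> ennreal) \<Rightarrow> real \<Rightarrow> 'w \<Rightarrow> ennreal" where
  "crm_integral g a w = (\<integral>\<^sup>+z. ennreal (fst (snd z)) * indicator {0..a} (fst z) * g (snd (snd z)) \<partial>N w)"

text \<open>The strong law along a geometric sequence. Jumps exceeding \<open>b ^ k\<close> before time \<open>b ^ k\<close>
  occur for finitely many \<open>k\<close> only, and the variances of the sums of the other jumps, divided by
  the squares of \<open>b ^ k\<close>, are summable; both facts need only the finite first moment of \<open>rho\<close>.\<close>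

lemma crm_integral_geometric:
  fixes b :: real and g :: "'x \<Rightarrow> ennreal"
  assumes b: "1 < b" and g [measurable]: "g \<in> borel_measurable borel" and g1: "\<And>x. g x \<le> 1"
  shows "AE w in M. (\<forall>\<^sub>F k in sequentially. crm_integral g (b ^ k) w < \<infinity>) \<and>
    (\<lambda>k. enn2real (crm_integral g (b ^ k) w) / b ^ k) \<longlonglongrightarrow> enn2real jump_mean * enn2real (\<integral>\<^sup>+x. g x \<partial>H)"
proof -
  define C where "C = b / (b - 1)"
  have C: "0 \<le> C"
    using b by (simp add: C_def)
  have bk: "0 < b ^ k" for k
    using b by simp
  have G1: "(\<integral>\<^sup>+x. g x \<partial>H) \<le> 1" and GG1: "(\<integral>\<^sup>+x. g x * g x \<partial>H) \<le> 1"
    using g1 H.emeasure_space_1 nn_integral_mono[of H g "\<lambda>_. 1"]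
      nn_integral_mono[of H "\<lambda>x. g x * g x" "\<lambda>_. 1"] mult_mono[of "g x" 1 "g x" 1 for x]
    by auto
  \<comment> \<open>The level \<open>b ^ k\<close> bounds size and time of a jump alike. The set
    \<open>B k\<close> below collects the jumps lost by the truncation.\<close>
  define h where "h k z = (ennreal (fst (snd z)) * indicator {..b ^ k} (fst (snd z)))
    * indicator {0..b ^ k} (fst z) * g (snd (snd z))" for k and z :: "real \<times> real \<times> 'x"
  have h [measurable]: "h k \<in> borel_measurable (mean_measure rho H)" for k
    unfolding h_def[abs_def] by measurable
  define T where "T k w = (\<integral>\<^sup>+z. h k z \<partial>N w)" for k w
  have T [measurable]: "T k \<in> borel_measurable M" for k
    unfolding T_def[abs_def] by measurable
  define B where "B k = ({0..b ^ k} \<times> {b ^ k<..} \<times> UNIV :: (real \<times> real \<times> 'x) set)" for k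
  have B [measurable]: "B k \<in> sets (mean_measure rho H)" for k
    unfolding B_def sets_mean_measure by (intro pair_measureI) auto
  define mt where "mt k = (\<integral>\<^sup>+s. ennreal s * indicator {..b ^ k} s \<partial>rho)" for k
  define q where "q k = (\<integral>\<^sup>+s. (ennreal s * indicator {..b ^ k} s) * (ennreal s * indicator {..b ^ k} s) \<partial>rho)" for k

  have eB: "emeasure (mean_measure rho H) (B k) = ennreal (b ^ k) * emeasure rho {b ^ k<..}" for k
  proof -
    have "emeasure (mean_measure rho H) (B k) = (\<integral>\<^sup>+z. indicator (B k) z \<partial>mean_measure rho H)"
      by simp
    also have "\<dots> = (\<integral>\<^sup>+z. indicator {b ^ k<..} (fst (snd z)) * indicator {0..b ^ k} (fst z) * 1 \<partial>mean_measure rho H)"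
      by (intro nn_integral_cong) (auto simp: B_def split: split_indicator)
    also have "\<dots> = ennreal (b ^ k) * emeasure rho {b ^ k<..}"
      using bk[of k] by (subst nn_integral_mean_measure_strip) (auto simp: rho_sets H.emeasure_space_1)
    finally show ?thesis .
  qed
  \<comment> \<open>The left side is the sum over \<open>k\<close> of the expected numbers of lost
    jumps. Exchanging sum and integral leaves, for each size \<open>s\<close>, the sum of the powers
    below \<open>s\<close>.\<close>
  have "(\<Sum>k. ennreal (b ^ k) * emeasure rho {b ^ k<..}) = (\<Sum>k. \<integral>\<^sup>+s. ennreal (b ^ k) * indicator {b ^ k<..} s \<partial>rho)"
    by (simp add: nn_integral_cmult rho_sets)
  also have "\<dots> = (\<integral>\<^sup>+s. (\<Sum>k. ennreal (b ^ k) * indicator {b ^ k<..} s) \<partial>rho)"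
    by (intro nn_integral_suminf[symmetric]) auto
  also have "\<dots> \<le> (\<integral>\<^sup>+s. ennreal C * ennreal s \<partial>rho)"
  proof (rule nn_integral_mono_AE, use AE_rho_pos in eventually_elim)
    case (elim s)
    have "(\<Sum>k. ennreal (b ^ k) * indicator {b ^ k<..} s) = (\<Sum>k. ennreal (b ^ k * indicator {b ^ k<..} s))"
      by (intro suminf_cong) (auto split: split_indicator)
    also have "\<dots> \<le> ennreal (C * s)"
      unfolding C_def using sum_powers_below_le[OF b, of s] elim b by (intro suminf_ennreal_le) auto
    finally show ?case
      using C by (simp add: ennreal_mult')
  qed
  also have "\<dots> = ennreal C * jump_mean"
    by (simp add: nn_integral_cmult jump_mean_def)
  also have "\<dots> < \<infinity>"
    using jump_mean_finite by (simp add: ennreal_mult_less_top)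
  finally have sumB: "(\<Sum>k. emeasure (mean_measure rho H) (B k)) \<noteq> \<infinity>"
    by (simp add: eB)
  have Bfin: "emeasure (mean_measure rho H) (B k) < \<infinity>" for k
    using rho_greaterThan_finite[OF bk, of k] by (simp add: eB ennreal_mult_less_top)
  have "summable (\<lambda>k. enn2real (emeasure (mean_measure rho H) (B k)))"
    using sumB Bfin by (intro summable_suminf_not_top) auto
  then have "summable (\<lambda>k. prob {w\<in>space M. emeasure (N w) (B k) \<noteq> 0})"
    by (rule summable_comparison_test') (use prob_emeasure_N_nonzero_le[OF B Bfin] in auto)
  then have "AE w in M. \<forall>\<^sub>F k in sequentially. w \<in> space M - {w\<in>space M. emeasure (N w) (B k) \<noteq> 0}"
    by (intro borel_cantelli_AE1) (auto simp: emeasure_eq_measure)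
  then have AE_ST: "AE w in M. \<forall>\<^sub>F k in sequentially. crm_integral g (b ^ k) w = T k w"
  proof eventually_elim
    case (elim w)
    then show ?case
    proof eventually_elim
      case (elim k)
      then have w: "w \<in> space M" and null: "emeasure (N w) (B k) = 0"
        by auto
      then have "AE z in N w. z \<notin> B k"
        using B by (intro AE_not_in) (auto simp: null_sets_def sets_N)
      \<comment> \<open>With \<open>B k\<close> null, the two integrands agree
        \<open>N w\<close>-almost everywhere: up to time \<open>b ^ k\<close> no size above
        \<open>b ^ k\<close> is charged.\<close>
      then show ?case
        unfolding crm_integral_def T_def h_def
        by (intro nn_integral_cong_AE, eventually_elim)
          (auto simp: B_def split: split_indicator)
    qed
  qed

  have eT: "(\<integral>\<^sup>+w. T k w \<partial>M) = ennreal (b ^ k) * (mt k * (\<integral>\<^sup>+x. g x \<partial>H))" for k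
    unfolding T_def nn_integral_Campbell[OF h] unfolding h_def mt_def
    using bk[of k] by (intro nn_integral_mean_measure_strip) auto
  define vr where "vr k = ennreal (b ^ k) * (q k * (\<integral>\<^sup>+x. g x * g x \<partial>H))" for k
  have "(\<integral>\<^sup>+z. h k z * h k z \<partial>mean_measure rho H) = vr k" for k
  proof -
    have "(\<integral>\<^sup>+z. h k z * h k z \<partial>mean_measure rho H) =
      (\<integral>\<^sup>+z. ((ennreal (fst (snd z)) * indicator {..b ^ k} (fst (snd z))) *
          (ennreal (fst (snd z)) * indicator {..b ^ k} (fst (snd z))))
        * indicator {0..b ^ k} (fst z) * (g (snd (snd z)) * g (snd (snd z))) \<partial>mean_measure rho H)"
      by (intro nn_integral_cong) (auto simp: h_def ac_simps split: split_indicator)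
    also have "\<dots> = vr k"
      using bk[of k] unfolding q_def vr_def
      by (intro nn_integral_mean_measure_strip) auto
    finally show ?thesis .
  qed
  then have eTT: "(\<integral>\<^sup>+w. T k w * T k w \<partial>M) = ennreal (b ^ k) * (mt k * (\<integral>\<^sup>+x. g x \<partial>H))
      * (ennreal (b ^ k) * (mt k * (\<integral>\<^sup>+x. g x \<partial>H))) + vr k" for k
    using nn_integral_Campbell_mult[OF h h, of k k] eT[of k] nn_integral_Campbell[OF h, of k]
    by (simp add: T_def)

  \<comment> \<open>Normalization divides the variance by the square of \<open>b ^ k\<close>,
    leaving \<open>q k / b ^ k\<close> up to a factor at most 1. Writing
    \<open>s\<^sup>2 / b ^ k\<close> as \<open>s\<close> times \<open>s / b ^ k\<close> brings in
    the second geometric bound.\<close>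
  have "(\<Sum>k. ennreal (1 / b ^ k) * q k) = (\<Sum>k. \<integral>\<^sup>+s. ennreal (1 / b ^ k) *
      ((ennreal s * indicator {..b ^ k} s) * (ennreal s * indicator {..b ^ k} s)) \<partial>rho)"
    unfolding q_def by (intro suminf_cong nn_integral_cmult[symmetric]) auto
  also have "\<dots> = (\<integral>\<^sup>+s. (\<Sum>k. ennreal (1 / b ^ k) *
      ((ennreal s * indicator {..b ^ k} s) * (ennreal s * indicator {..b ^ k} s))) \<partial>rho)"
    by (intro nn_integral_suminf[symmetric]) auto
  also have "\<dots> \<le> (\<integral>\<^sup>+s. ennreal C * ennreal s \<partial>rho)"
  proof (rule nn_integral_mono_AE, use AE_rho_pos in eventually_elim)
    case (elim s)
    have "(\<Sum>k. ennreal (1 / b ^ k) * ((ennreal s * indicator {..b ^ k} s) * (ennreal s * indicator {..b ^ k} s)))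
        = (\<Sum>k. ennreal s * ennreal (s / b ^ k * indicator {..b ^ k} s))"
      using elim b by (intro suminf_cong) (auto simp: ennreal_mult'[symmetric] split: split_indicator)
    also have "\<dots> = ennreal s * (\<Sum>k. ennreal (s / b ^ k * indicator {..b ^ k} s))"
      by simp
    also have "\<dots> \<le> ennreal s * ennreal C"
      unfolding C_def using sum_inverse_powers_above_le[OF b, of s] elim b
      by (intro mult_left_mono suminf_ennreal_le) auto
    finally show ?case
      by (simp add: mult.commute)
  qed
  also have "\<dots> = ennreal C * jump_mean"
    by (simp add: nn_integral_cmult jump_mean_def)
  also have "\<dots> < \<infinity>"
    using jump_mean_finite by (simp add: ennreal_mult_less_top)
  finally have sumq: "(\<Sum>k. ennreal (1 / b ^ k) * q k) < \<infinity>" .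
  have qfin: "q k < \<infinity>" for k
  proof -
    have "ennreal (1 / b ^ k) * q k < \<infinity>"
      using sumq sum_le_suminf[of "\<lambda>k. ennreal (1 / b ^ k) * q k" "{k}"] by (auto intro: le_less_trans)
    then show ?thesis
      using b by (auto simp: ennreal_mult_less_top)
  qed
  have vfin: "vr k < \<infinity>" for k
    using qfin[of k] GG1 by (auto simp: vr_def ennreal_mult_less_top intro: le_less_trans)
  have mt_le: "mt k \<le> jump_mean" for k
    unfolding mt_def jump_mean_def by (intro nn_integral_mono) (auto split: split_indicator)
  have mtfin: "mt k < \<infinity>" for k
    using mt_le jump_mean_finite by (rule le_less_trans)
  have efin: "ennreal (b ^ k) * (mt k * (\<integral>\<^sup>+x. g x \<partial>H)) < \<infinity>" for k
    using mtfin[of k] G1 by (auto simp: ennreal_mult_less_top intro: le_less_trans)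

  define D where "D k w = enn2real (T k w) / b ^ k - enn2real (mt k) * enn2real (\<integral>\<^sup>+x. g x \<partial>H)" for k w
  have D [measurable]: "D k \<in> borel_measurable M" for k
    unfolding D_def[abs_def] by measurable
  have eD: "(\<integral>\<^sup>+w. ennreal ((D k w)\<^sup>2) \<partial>M) \<le> ennreal (1 / b ^ k) * q k" for k
  proof -
    define e where "e = ennreal (b ^ k) * (mt k * (\<integral>\<^sup>+x. g x \<partial>H))"
    have e: "enn2real e = b ^ k * (enn2real (mt k) * enn2real (\<integral>\<^sup>+x. g x \<partial>H))"
      using bk[of k] by (simp add: e_def enn2real_mult)
    have "(\<integral>\<^sup>+w. ennreal ((D k w)\<^sup>2) \<partial>M)
        = (\<integral>\<^sup>+w. ennreal ((1 / b ^ k)\<^sup>2) * ennreal ((enn2real (T k w) - enn2real e)\<^sup>2) \<partial>M)"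
    proof (intro nn_integral_cong)
      fix w
      have "D k w = (1 / b ^ k) * (enn2real (T k w) - enn2real e)"
        using b by (simp add: D_def e right_diff_distrib)
      then show "ennreal ((D k w)\<^sup>2) = ennreal ((1 / b ^ k)\<^sup>2) * ennreal ((enn2real (T k w) - enn2real e)\<^sup>2)"
        by (simp only: power_mult_distrib ennreal_mult' zero_le_power2)
    qed
    also have "\<dots> = ennreal ((1 / b ^ k)\<^sup>2) * vr k"
      using nn_integral_variance[OF T eT eTT efin vfin, of k]
      by (subst nn_integral_cmult) (auto simp: e_def)
    also have "\<dots> = (ennreal ((1 / b ^ k)\<^sup>2) * ennreal (b ^ k)) * (q k * (\<integral>\<^sup>+x. g x * g x \<partial>H))"
      by (simp add: vr_def ac_simps)
    also have "ennreal ((1 / b ^ k)\<^sup>2) * ennreal (b ^ k) = ennreal (1 / b ^ k)"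
      using bk[of k] by (simp add: ennreal_mult'[symmetric] power2_eq_square)
    also have "ennreal (1 / b ^ k) * (q k * (\<integral>\<^sup>+x. g x * g x \<partial>H)) \<le> ennreal (1 / b ^ k) * (q k * 1)"
      using GG1 by (intro mult_left_mono) auto
    finally show ?thesis by simp
  qed
  \<comment> \<open>The expected sum of squares is finite, so the sum itself is almost surely finite
    and its terms tend to 0; no deviation threshold has to be chosen.\<close>
  have "(\<integral>\<^sup>+w. (\<Sum>k. ennreal ((D k w)\<^sup>2)) \<partial>M) = (\<Sum>k. \<integral>\<^sup>+w. ennreal ((D k w)\<^sup>2) \<partial>M)"
    by (intro nn_integral_suminf) auto
  also have "\<dots> \<le> (\<Sum>k. ennreal (1 / b ^ k) * q k)"
    by (intro suminf_le eD) auto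
  finally have "(\<integral>\<^sup>+w. (\<Sum>k. ennreal ((D k w)\<^sup>2)) \<partial>M) \<noteq> \<infinity>"
    using sumq by auto
  then have "AE w in M. (\<Sum>k. ennreal ((D k w)\<^sup>2)) \<noteq> \<infinity>"
    by (intro nn_integral_PInf_AE) auto
  then have AE_D: "AE w in M. (\<lambda>k. D k w) \<longlonglongrightarrow> 0"
  proof eventually_elim
    case (elim w)
    then have "summable (\<lambda>k. (D k w)\<^sup>2)"
      by (intro summable_suminf_not_top) auto
    then have "(\<lambda>k. sqrt ((D k w)\<^sup>2)) \<longlonglongrightarrow> sqrt 0"
      by (intro tendsto_real_sqrt summable_LIMSEQ_zero)
    then show ?case
      by (simp add: tendsto_rabs_zero_iff)
  qed
  \<comment> \<open>\<open>enn2real\<close> sends infinity to 0, so convergence of the real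
    quotients says nothing about finiteness, which is tracked separately.\<close>
  have "AE w in M. T k w \<noteq> \<infinity>" for k
    using eT[of k] efin[of k] by (intro nn_integral_PInf_AE) auto
  then have AE_T: "AE w in M. \<forall>k. T k w \<noteq> \<infinity>"
    by (simp add: AE_all_countable)
  \<comment> \<open>Centering used the truncated mean; monotone convergence shows that this bias
    disappears in the limit.\<close>
  have "mt \<longlonglongrightarrow> jump_mean"
    unfolding mt_def[abs_def] jump_mean_def
  proof (intro nn_integral_LIMSEQ)
    have "b ^ i \<le> b ^ j" if "i \<le> j" for i j
      using b that by (intro power_increasing) auto
    then show "incseq (\<lambda>k s. ennreal s * indicator {..b ^ k} s)"
      by (force simp: incseq_def le_fun_def split: split_indicator)
    fix s :: real
    obtain n where n: "s < b ^ n"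
      using real_arch_pow[OF b] by blast
    have "\<forall>\<^sub>F k in sequentially. ennreal s * indicator {..b ^ k} s = ennreal s"
      using eventually_ge_at_top[of n]
    proof eventually_elim
      case (elim k)
      then have "b ^ n \<le> b ^ k"
        using b by (intro power_increasing) auto
      then show ?case using n by simp
    qed
    then show "(\<lambda>k. ennreal s * indicator {..b ^ k} s) \<longlonglongrightarrow> ennreal s"
      by (rule tendsto_eventually)
  qed auto
  then have mt_lim: "(\<lambda>k. enn2real (mt k)) \<longlonglongrightarrow> enn2real jump_mean"
    using jump_mean_finite by (intro tendsto_enn2real) auto
  show ?thesis
    using AE_ST AE_D AE_T
  proof eventually_elim
    case (elim w)
    have "(\<lambda>k. D k w + enn2real (mt k) * enn2real (\<integral>\<^sup>+x. g x \<partial>H))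
        \<longlonglongrightarrow> 0 + enn2real jump_mean * enn2real (\<integral>\<^sup>+x. g x \<partial>H)"
      by (intro tendsto_add tendsto_mult tendsto_const elim(2) mt_lim)
    then have "(\<lambda>k. enn2real (T k w) / b ^ k) \<longlonglongrightarrow> enn2real jump_mean * enn2real (\<integral>\<^sup>+x. g x \<partial>H)"
      by (simp add: D_def)
    moreover have "\<forall>\<^sub>F k in sequentially. enn2real (T k w) / b ^ k = enn2real (crm_integral g (b ^ k) w) / b ^ k"
      using elim(1) by eventually_elim simp
    ultimately have "(\<lambda>k. enn2real (crm_integral g (b ^ k) w) / b ^ k) \<longlonglongrightarrow> enn2real jump_mean * enn2real (\<integral>\<^sup>+x. g x \<partial>H)"
      by (rule Lim_transform_eventually)
    moreover have "\<forall>\<^sub>F k in sequentially. crm_integral g (b ^ k) w < \<infinity>"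
      using elim(1) by eventually_elim (use elim(3) in \<open>auto simp: top.not_eq_extremum\<close>)
    ultimately show ?case by blast
  qed
qed

end

section \<open>Real parameters, normalization and the metric\<close>

text \<open>The conventions agree at 0: \<open>inverse 0\<close> is infinite in
  \<open>ennreal\<close> and \<open>enn2real\<close> sends it to 0, which is also
  \<open>inverse 0\<close> in the reals. The normalizing factor thus passes to the reals without
  side conditions.\<close>

lemma enn2real_inverse: "enn2real (inverse x) = inverse (enn2real x)"
proof (cases x)
  case (real r)
  then show ?thesis
    by (cases "r = 0") (auto simp: inverse_ennreal)
qed simp

lemma ennreal_inverse_mult_cancel:
  fixes x :: ennreal
  assumes "x \<noteq> 0" "x < \<infinity>"
  shows "inverse x * x = 1"
  using assms by (metis divide_ennreal_def ennreal_divide_self infinity_ennreal_def mult.commute)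

context levy_prm
begin

lemma crm_integral_mono: "a \<le> c \<Longrightarrow> crm_integral g a w \<le> crm_integral g c w"
  unfolding crm_integral_def by (intro nn_integral_mono) (auto split: split_indicator)

lemma crm_integral_strong_law:
  fixes g :: "'x \<Rightarrow> ennreal"
  assumes g: "g \<in> borel_measurable borel" and g1: "\<And>x. g x \<le> 1"
  shows "AE w in M. (\<forall>a. crm_integral g a w < \<infinity>) \<and>
    ((\<lambda>a. enn2real (crm_integral g a w) / a) \<longlongrightarrow> enn2real jump_mean * enn2real (\<integral>\<^sup>+x. g x \<partial>H)) at_top"
proof -
  let ?b = "\<lambda>j::nat. 1 + 1 / real (Suc j)"
  have "AE w in M. \<forall>j. (\<forall>\<^sub>F k in sequentially. crm_integral g (?b j ^ k) w < \<infinity>) \<and>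
    (\<lambda>k. enn2real (crm_integral g (?b j ^ k) w) / ?b j ^ k) \<longlonglongrightarrow> enn2real jump_mean * enn2real (\<integral>\<^sup>+x. g x \<partial>H)"
    unfolding AE_all_countable by (intro allI crm_integral_geometric assms) simp
  then show ?thesis
  proof eventually_elim
    case (elim w)
    \<comment> \<open>Finiteness for large powers of \<open>?b 0\<close>, which is 2, passes to
      every \<open>a\<close> because \<open>crm_integral\<close> increases in
      \<open>a\<close>.\<close>
    have fin: "crm_integral g a w < \<infinity>" for a
    proof -
      obtain n where n: "a < ?b 0 ^ n"
        using real_arch_pow[of "?b 0" a] by auto
      obtain K where K: "\<And>k. K \<le> k \<Longrightarrow> crm_integral g (?b 0 ^ k) w < \<infinity>"
        using elim[rule_format, of 0] by (auto simp: eventually_sequentially)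
      have "?b 0 ^ n \<le> ?b 0 ^ max n K"
        by (intro power_increasing) auto
      then have "crm_integral g a w \<le> crm_integral g (?b 0 ^ max n K) w"
        using n by (intro crm_integral_mono) linarith
      also have "\<dots> < \<infinity>"
        by (rule K) simp
      finally show ?thesis .
    qed
    moreover have "((\<lambda>a. enn2real (crm_integral g a w) / a) \<longlongrightarrow> enn2real jump_mean * enn2real (\<integral>\<^sup>+x. g x \<partial>H)) at_top"
      using elim fin by (intro tendsto_div_self_of_geometric) (auto intro!: enn2real_mono crm_integral_mono)
    ultimately show ?case by blast
  qed
qed

lemma sets_N_borel [measurable_cong]:
  "w \<in> space M \<Longrightarrow> sets (N w) = sets (borel \<Otimes>\<^sub>M (borel \<Otimes>\<^sub>M borel))"
  by (simp add: sets_N sets_mean_measure)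

lemma sets_hnrmi [simp]: "sets (hnrmi N a w) = sets borel"
  by (simp add: hnrmi_def crm_def)

lemma space_hnrmi [simp]: "space (hnrmi N a w) = UNIV"
  by (simp add: hnrmi_def crm_def)

lemma nn_integral_crm:
  assumes w: "w \<in> space M" and g [measurable]: "g \<in> borel_measurable borel"
  shows "(\<integral>\<^sup>+x. g x \<partial>crm N a w) = crm_integral g a w"
proof -
  note [measurable_cong] = sets_N_borel[OF w]
  have [simp]: "indicator ({0..a} \<times> UNIV) z = (indicator {0..a} (fst z) :: ennreal)"
    for z :: "real \<times> real \<times> 'x"
    by (cases z) (auto split: split_indicator)
  show ?thesis
    unfolding crm_def crm_integral_def
    by (simp add: nn_integral_distr nn_integral_density)
qed

lemma nn_integral_hnrmi:
  assumes w: "w \<in> space M" and g: "g \<in> borel_measurable borel"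
  shows "(\<integral>\<^sup>+x. g x \<partial>hnrmi N a w) = inverse (crm_integral (\<lambda>_. 1) a w) * crm_integral g a w"
proof -
  have "emeasure (crm N a w) (space (crm N a w)) = crm_integral (\<lambda>_. 1) a w"
    using nn_integral_crm[OF w, of "\<lambda>_. 1" a] by simp
  moreover have "g \<in> borel_measurable (crm N a w)"
    using g by (simp add: crm_def)
  ultimately show ?thesis
    unfolding hnrmi_def using nn_integral_crm[OF w g]
    by (simp add: nn_integral_density nn_integral_cmult)
qed

text \<open>Positivity of the total mass for large \<open>a\<close> is read off from its linear
  growth at the positive rate \<open>jump_mean\<close>. The threshold depends on \<open>w\<close>,
  but the null set does not depend on \<open>a\<close>.\<close>

lemma AE_prob_space_hnrmi: "AE w in M. \<forall>\<^sub>F a in at_top. prob_space (hnrmi N a w)"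
  using crm_integral_strong_law[of "\<lambda>_. 1", OF borel_measurable_const order_refl] AE_space
proof eventually_elim
  case (elim w)
  have "0 < enn2real jump_mean"
    using jump_mean_pos jump_mean_finite by (simp add: enn2real_positive_iff)
  then have "\<forall>\<^sub>F a in at_top. 0 < enn2real (crm_integral (\<lambda>_. 1) a w) / a"
    using elim by (intro order_tendstoD(1)[where y = "enn2real jump_mean"]) (auto simp: H.emeasure_space_1)
  then show ?case
  proof eventually_elim
    case (elim a)
    then have "crm_integral (\<lambda>_. 1) a w \<noteq> 0"
      by auto
    moreover have "crm_integral (\<lambda>_. 1) a w < \<infinity>"
      using \<open>(\<forall>a. crm_integral (\<lambda>_. 1) a w < \<infinity>) \<and> _\<close> by blast
    moreover have "emeasure (hnrmi N a w) (space (hnrmi N a w)) = inverse (crm_integral (\<lambda>_. 1) a w) * crm_integral (\<lambda>_. 1) a w"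
      using nn_integral_hnrmi[OF \<open>w \<in> space M\<close>, of "\<lambda>_. 1" a] by simp
    ultimately show ?case
      by (intro prob_spaceI) (simp add: ennreal_inverse_mult_cancel)
  qed
qed

lemma hnrmi_strong_law:
  fixes g :: "'x \<Rightarrow> ennreal"
  assumes g: "g \<in> borel_measurable borel" and g1: "\<And>x. g x \<le> 1"
  shows "AE w in M. ((\<lambda>a. enn2real (\<integral>\<^sup>+x. g x \<partial>hnrmi N a w)) \<longlongrightarrow> enn2real (\<integral>\<^sup>+x. g x \<partial>H)) at_top"
  using crm_integral_strong_law[of "\<lambda>_. 1", OF borel_measurable_const order_refl] crm_integral_strong_law[OF assms] AE_space
proof eventually_elim
  case (elim w)
  have pos: "0 < enn2real jump_mean"
    using jump_mean_pos jump_mean_finite by (simp add: enn2real_positive_iff)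
  have "((\<lambda>a. (enn2real (crm_integral g a w) / a) / (enn2real (crm_integral (\<lambda>_. 1) a w) / a)) \<longlongrightarrow>
      (enn2real jump_mean * enn2real (\<integral>\<^sup>+x. g x \<partial>H)) / enn2real jump_mean) at_top"
    using elim pos by (intro tendsto_divide) (auto simp: H.emeasure_space_1)
  \<comment> \<open>For \<open>a > 0\<close> the factor \<open>a\<close> cancels;
    \<open>enn2real_inverse\<close> covers zero or infinite total mass as well.\<close>
  moreover have "\<forall>\<^sub>F a in at_top. (enn2real (crm_integral g a w) / a) / (enn2real (crm_integral (\<lambda>_. 1) a w) / a)
      = enn2real (\<integral>\<^sup>+x. g x \<partial>hnrmi N a w)"
    using eventually_gt_at_top[of 0]
  proof eventually_elim
    case (elim a)
    then show ?case
      using nn_integral_hnrmi[OF \<open>w \<in> space M\<close> g, of a]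
      by (simp add: enn2real_mult enn2real_inverse divide_inverse)
  qed
  ultimately show ?case
    using pos by (simp add: tendsto_cong)
qed

text \<open>An affine map takes \<open>f\<close> into the unit interval, where the law for
  nonnegative integrands applies. Undoing the map uses total mass 1, hence the appeal to
  \<open>AE_prob_space_hnrmi\<close>.\<close>

lemma hnrmi_strong_law_integral:
  fixes f :: "'x \<Rightarrow> real"
  assumes f [measurable]: "f \<in> borel_measurable borel" and bdd: "bounded (range f)"
  shows "AE w in M. ((\<lambda>a. \<integral>x. f x \<partial>hnrmi N a w) \<longlongrightarrow> (\<integral>x. f x \<partial>H)) at_top"
proof -
  obtain K where K: "0 < K" "\<And>x. \<bar>f x\<bar> \<le> K"
    using bdd unfolding bounded_pos by auto
  define g where "g x = (f x + K) / (2 * K)" for x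
  have fK: "- K \<le> f x" "f x \<le> K" for x
    using K(2)[of x] by auto
  have g: "0 \<le> g x" "g x \<le> 1" for x
    using fK[of x] K by (auto simp: g_def divide_simps)
  have gm [measurable]: "g \<in> borel_measurable borel"
    unfolding g_def[abs_def] by measurable
  have int: "(\<integral>x. f x \<partial>Q) = 2 * K * enn2real (\<integral>\<^sup>+x. ennreal (g x) \<partial>Q) - K"
    if "prob_space Q" and Q [measurable_cong]: "sets Q = sets borel" for Q :: "'x measure"
  proof -
    interpret Q: prob_space Q by fact
    have "integrable Q g"
      using g by (intro Q.integrable_const_bound[of _ 1]) auto
    then have "(\<integral>x. 2 * K * g x - K \<partial>Q) = 2 * K * (\<integral>x. g x \<partial>Q) - K"
      by (simp add: Q.prob_space)
    moreover have "2 * K * g x - K = f x" for x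
      using K by (simp add: g_def)
    moreover have "(\<integral>x. g x \<partial>Q) = enn2real (\<integral>\<^sup>+x. ennreal (g x) \<partial>Q)"
      using g by (intro integral_eq_nn_integral) auto
    ultimately show ?thesis by simp
  qed
  have "AE w in M. ((\<lambda>a. enn2real (\<integral>\<^sup>+x. ennreal (g x) \<partial>hnrmi N a w))
      \<longlongrightarrow> enn2real (\<integral>\<^sup>+x. ennreal (g x) \<partial>H)) at_top"
    using g by (intro hnrmi_strong_law) auto
  then show ?thesis
    using AE_prob_space_hnrmi
  proof eventually_elim
    case (elim w)
    have "((\<lambda>a. 2 * K * enn2real (\<integral>\<^sup>+x. ennreal (g x) \<partial>hnrmi N a w) - K)
        \<longlongrightarrow> 2 * K * enn2real (\<integral>\<^sup>+x. ennreal (g x) \<partial>H) - K) at_top"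
      by (intro tendsto_intros elim)
    moreover have "\<forall>\<^sub>F a in at_top. 2 * K * enn2real (\<integral>\<^sup>+x. ennreal (g x) \<partial>hnrmi N a w) - K
        = (\<integral>x. f x \<partial>hnrmi N a w)"
      using elim(2) by eventually_elim (simp add: int)
    ultimately show ?case
      using int[OF H_prob H_sets] by (simp add: tendsto_cong)
  qed
qed

text \<open>Capping each term at 1 gives the summable majorant \<open>(1/2) ^ Suc i\<close>
  uniformly in \<open>a\<close>, so Tannery's theorem moves the limit inside the series.\<close>

lemma hnrmi_dM_tendsto:
  fixes f :: "nat \<Rightarrow> 'x \<Rightarrow> real"
  assumes "\<And>i. f i \<in> borel_measurable borel" and "\<And>i. bounded (range (f i))"
  shows "AE w in M. ((\<lambda>a. dM f (hnrmi N a w) H) \<longlongrightarrow> 0) at_top"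
proof -
  have "AE w in M. \<forall>i. ((\<lambda>a. \<integral>x. f i x \<partial>hnrmi N a w) \<longlongrightarrow> (\<integral>x. f i x \<partial>H)) at_top"
    unfolding AE_all_countable using assms by (intro allI hnrmi_strong_law_integral)
  then show ?thesis
  proof eventually_elim
    case (elim w)
    let ?t = "\<lambda>i a. (1/2) ^ Suc i * min \<bar>(\<integral>x. f i x \<partial>hnrmi N a w) - (\<integral>x. f i x \<partial>H)\<bar> (1::real)"
    have "((\<lambda>a. \<Sum>i. ?t i a) \<longlongrightarrow> (\<Sum>i::nat. 0)) at_top"
    proof (rule tannerys_theorem[THEN conjunct2, THEN conjunct2])
      fix i
      have "((\<lambda>a. ?t i a) \<longlongrightarrow> (1/2) ^ Suc i * min \<bar>(\<integral>x. f i x \<partial>H) - (\<integral>x. f i x \<partial>H)\<bar> 1) at_top"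
        using elim by (intro tendsto_intros) auto
      then show "((\<lambda>a. ?t i a) \<longlongrightarrow> 0) at_top"
        by simp
    next
      show "\<forall>\<^sub>F (i, a) in sequentially \<times>\<^sub>F at_top. norm (?t i a) \<le> (1/2) ^ Suc i"
        by (intro always_eventually) (auto simp: abs_mult)
      show "summable (\<lambda>i. (1/2::real) ^ Suc i)"
        by (subst summable_Suc_iff) (auto intro: summable_geometric)
    qed auto
    then show ?case
      by (simp add: dM_def)
  qed
qed

end

section \<open>Uniform convergence of distribution functions\<close>

text \<open>Without atoms the distribution function is continuous with limits 0 and 1, so the
  intermediate value theorem applies.\<close>

lemma (in real_distribution) nonatomic_quantile_exists:
  assumes "\<And>x. prob {x} = 0" "0 < p" "p < 1"
  shows "\<exists>x. prob {..x} = p"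
proof -
  have "\<forall>\<^sub>F x in at_bot. cdf M x < p"
    using cdf_lim_at_bot assms by (auto intro: order_tendstoD)
  then obtain l where l: "\<And>x. x \<le> l \<Longrightarrow> cdf M x < p"
    by (auto simp: eventually_at_bot_linorder)
  have "\<forall>\<^sub>F x in at_top. p < cdf M x"
    using cdf_lim_at_top_prob assms by (auto intro: order_tendstoD)
  then obtain u where u: "\<And>x. u \<le> x \<Longrightarrow> p < cdf M x"
    by (auto simp: eventually_at_top_linorder)
  have "l \<le> u"
    using l[of u] u[of u] by force
  then have "\<exists>x\<ge>l. x \<le> u \<and> cdf M x = p"
    using l[of l] u[of u] assms isCont_cdf by (intro IVT) (auto intro: less_imp_le)
  then show ?thesis
    by (auto simp: cdf_def)
qed

text \<open>By monotonicity both distribution functions at \<open>y\<close> are caught between their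
  values at neighbouring grid points, between which that of \<open>H\<close> grows by
  \<open>1 / n\<close>. Left and right of the grid, the bounds 0 and 1 stand in for the missing
  points.\<close>

lemma cdf_diff_le_of_quantile_grid:
  fixes P H :: "real measure" and q :: "nat \<Rightarrow> real"
  assumes P: "real_distribution P" and H: "real_distribution H" and n: "0 < n"
    and q: "\<And>j. 0 < j \<Longrightarrow> j < n \<Longrightarrow> measure H {..q j} = real j / real n"
    and d: "\<And>j. 0 < j \<Longrightarrow> j < n \<Longrightarrow> \<bar>measure P {..q j} - measure H {..q j}\<bar> \<le> d" and d0: "0 \<le> d"
  shows "\<bar>measure P {..y} - measure H {..y}\<bar> \<le> d + 1 / n"
proof -
  interpret P: real_distribution P by fact
  interpret H: real_distribution H by fact
  define F where "F = measure H {..y}"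
  have F: "0 \<le> F" "F \<le> 1"
    by (auto simp: F_def)
  have upper: "measure P {..y} \<le> F + 1 / n + d"
  proof -
    \<comment> \<open>The least index with \<open>j / n\<close> strictly above \<open>F\<close>.
      Strictness forces \<open>y \<le> q j\<close>; equal values would not, as the distribution
      function may be constant in places.\<close>
    define j where "j = Suc (nat \<lfloor>n * F\<rfloor>)"
    have j: "n * F < j" "j \<le> n * F + 1"
      using F by (auto simp: j_def) linarith+
    show ?thesis
    proof (cases "j < n")
      case True
      have "F < real j / n"
        using j n by (simp add: field_simps)
      also have "\<dots> = measure H {..q j}"
        using q[of j] True by (simp add: j_def)
      finally have "y \<le> q j"
        unfolding F_def using H.finite_measure_mono[of "{..q j}" "{..y}"] by force
      then have "measure P {..y} \<le> measure P {..q j}"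
        by (intro P.finite_measure_mono) auto
      also have "\<dots> \<le> real j / n + d"
        using d[of j] q[of j] True by (simp add: j_def)
      also have "real j / n \<le> (n * F + 1) / n"
        using j n by (intro divide_right_mono) auto
      also have "(n * F + 1) / n = F + 1 / n"
        using n by (simp add: field_simps)
      finally show ?thesis by simp
    next
      case False
      then have "real n \<le> n * F + 1"
        using j by linarith
      then have "1 \<le> F + 1 / n"
        using n by (simp add: field_simps)
      then show ?thesis
        using d0 P.prob_le_1[of "{..y}"] by linarith
    qed
  qed
  have lower: "F - 1 / n - d \<le> measure P {..y}"
  proof -
    \<comment> \<open>For \<open>F > 0\<close>, the largest index with \<open>j / n\<close> strictly
      below \<open>F\<close>; at \<open>F = 0\<close> the value -1 is cut to 0 by
      \<open>nat\<close>.\<close>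
    define j where "j = nat (\<lceil>n * F\<rceil> - 1)"
    have "real n * F \<le> real n * 1"
      using F by (intro mult_left_mono) auto
    then have nF: "n * F \<le> n" by simp
    show ?thesis
    proof (cases "0 < j")
      case True
      then have j: "j < n * F" "n * F \<le> j + 1"
        by (auto simp: j_def) linarith+
      then have jn: "j < n"
        using nF by linarith
      have "measure H {..q j} = real j / n"
        using q[of j] True jn by simp
      also have "\<dots> < F"
        using j n by (simp add: field_simps)
      finally have "q j \<le> y"
        unfolding F_def using H.finite_measure_mono[of "{..y}" "{..q j}"] by force
      have "F = n * F / n"
        using n by simp
      also have "\<dots> \<le> (j + 1) / n"
        using j n by (intro divide_right_mono) auto
      finally have "F - 1 / n - d \<le> real j / n - d"
        by (simp add: add_divide_distrib)
      also have "\<dots> \<le> measure P {..q j}"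
        using d[of j] q[of j] True jn by simp
      also have "\<dots> \<le> measure P {..y}"
        using \<open>q j \<le> y\<close> by (intro P.finite_measure_mono) auto
      finally show ?thesis .
    next
      case False
      then have "n * F \<le> 1"
        by (simp add: j_def)
      then have "F \<le> 1 / n"
        using n by (simp add: field_simps)
      then show ?thesis
        using d0 measure_nonneg[of P "{..y}"] by linarith
    qed
  qed
  show ?thesis
    using upper lower by (simp add: F_def abs_le_iff)
qed

theorem hnrmi_Glivenko_Cantelli:
  fixes M :: "'w measure" and N :: "'w \<Rightarrow> (real \<times> real \<times> real) measure" and H :: "real measure"
  assumes "levy_prm M N rho H" and nonatomic: "\<And>x. emeasure H {x} = 0"
  shows "AE w in M. ((\<lambda>a. SUP x. \<bar>measure (hnrmi N a w) {..x} - measure H {..x}\<bar>) \<longlongrightarrow> 0) at_top"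
proof -
  interpret levy_prm M N rho H by fact
  have H: "real_distribution H"
    by unfold_locales (auto simp: H_sets sets_eq_imp_space_eq[OF H_sets])
  interpret H: real_distribution H by fact
  \<comment> \<open>Outside \<open>0 < j < n\<close> the chosen point is unspecified. Convergence
    holds at any point, so the null sets below are collected over all \<open>n\<close> and
    \<open>j\<close>.\<close>
  define q where "q n j = (SOME x. measure H {..x} = real j / real n)" for n j :: nat
  have q: "measure H {..q n j} = real j / real n" if "0 < j" "j < n" for n j
    unfolding q_def
    using H.nonatomic_quantile_exists[of "real j / real n"] nonatomic that
    by (intro someI_ex[where P = "\<lambda>x. measure H {..x} = real j / real n"]) (auto simp: measure_def)
  have "AE w in M. \<forall>n j. ((\<lambda>a. measure (hnrmi N a w) {..q n j}) \<longlongrightarrow> measure H {..q n j}) at_top"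
    unfolding AE_all_countable
  proof (intro allI)
    fix n j :: nat
    have indicator_le: "indicator {..q n j} x \<le> (1::ennreal)" for x
      by (simp split: split_indicator)
    show "AE w in M. ((\<lambda>a. measure (hnrmi N a w) {..q n j}) \<longlongrightarrow> measure H {..q n j}) at_top"
      using hnrmi_strong_law[of "indicator {..q n j}", OF _ indicator_le]
      by (simp add: measure_def)
  qed
  then show ?thesis
    using AE_prob_space_hnrmi
  proof eventually_elim
    case (elim w)
    show ?case
    proof (rule tendstoI)
      fix e :: real assume e: "0 < e"
      obtain n0 where n0: "1 / real (Suc n0) < e / 2"
        using nat_approx_posE[of "e / 2"] e by auto
      define n where "n = Suc n0"
      \<comment> \<open>On a fixed finite grid pointwise convergence is uniform. The error
        \<open>e / 4\<close> plus the mesh \<open>1 / n < e / 2\<close> stays below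
        \<open>e\<close>.\<close>
      have "\<forall>\<^sub>F a in at_top. \<forall>j\<in>{..<n}. dist (measure (hnrmi N a w) {..q n j}) (measure H {..q n j}) < e / 4"
        using elim(1) e by (intro eventually_ball_finite ballI tendstoD) auto
      then show "\<forall>\<^sub>F a in at_top. dist (SUP x. \<bar>measure (hnrmi N a w) {..x} - measure H {..x}\<bar>) 0 < e"
        using elim(2)
      proof eventually_elim
        case (elim a)
        have P: "real_distribution (hnrmi N a w)"
          using elim(2) by (simp add: real_distribution_def real_distribution_axioms_def)
        have le: "\<bar>measure (hnrmi N a w) {..x} - measure H {..x}\<bar> \<le> e / 4 + 1 / n" for x
          using elim(1) e by (intro cdf_diff_le_of_quantile_grid[OF P H _ q])
            (auto simp: n_def dist_real_def intro: less_imp_le)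
        have "(SUP x. \<bar>measure (hnrmi N a w) {..x} - measure H {..x}\<bar>) \<le> e / 4 + 1 / n"
          using le by (intro cSUP_least) auto
        moreover have "0 \<le> (SUP x. \<bar>measure (hnrmi N a w) {..x} - measure H {..x}\<bar>)"
          using le by (intro cSUP_upper2[of _ _ 0]) (auto intro!: bdd_aboveI2)
        ultimately show ?case
          using n0 e by (simp add: n_def dist_real_def)
      qed
    qed
  qed
qed

text \<open>The second conjunct lives on the type \<open>real\<close>, whereas the type of
  \<open>H\<close> is arbitrary. It therefore quantifies over its own probability space, Poisson
  measure and base measure, sharing only \<open>rho\<close>, and instantiates
  \<open>levy_prm\<close> a second time.\<close>

theorem theorem1:
  fixes M :: "'w measure"
    and N :: "'w \<Rightarrow> (real \<times> real \<times> 'x::polish_space) measure"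
    and rho :: "real measure"
    and H :: "'x measure"
    and f :: "nat \<Rightarrow> 'x \<Rightarrow> real"
  assumes rho_sets: "sets rho = sets borel"
    and rho_supp: "emeasure rho {..0} = 0"
    and rho_levy: "(\<integral>\<^sup>+ s. ennreal (min s 1) \<partial>rho) < \<infinity>"
    and rho_inf: "emeasure rho {0<..} = \<infinity>"
    and tau1: "(\<integral>\<^sup>+ s. ennreal s * indicator {1..} s \<partial>rho) < \<infinity>"
    and H_prob: "prob_space H"
    and H_sets: "sets H = sets borel"
    and H_nonatomic: "\<And>x. emeasure H {x} = 0"
    and N_prm: "poisson_random_measure M N (mean_measure rho H)"
    and f_cont: "\<And>i. continuous_on UNIV (f i)"
    and f_bdd: "\<And>i. bounded (range (f i))"
  shows "(AE w in M. ((\<lambda>a. dM f (hnrmi N a w) H) \<longlongrightarrow> 0) at_top)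
       \<and> (\<forall>(M' :: 'v measure) (N' :: 'v \<Rightarrow> (real \<times> real \<times> real) measure) (H' :: real measure).
            prob_space H' \<and> sets H' = sets borel \<and> (\<forall>x. emeasure H' {x} = 0) \<and>
            poisson_random_measure M' N' (mean_measure rho H') \<longrightarrow>
            (AE w in M'. ((\<lambda>a. SUP x. \<bar>measure (hnrmi N' a w) {..x} - measure H' {..x}\<bar>)
                \<longlongrightarrow> 0) at_top))"
proof (intro conjI allI impI)
  interpret levy_prm M N rho H
    using assms by (intro levy_prm.intro)
  show "AE w in M. ((\<lambda>a. dM f (hnrmi N a w) H) \<longlongrightarrow> 0) at_top"
    using f_cont f_bdd by (intro hnrmi_dM_tendsto borel_measurable_continuous_onI)
next
  fix M' :: "'v measure" and N' :: "'v \<Rightarrow> (real \<times> real \<times> real) measure" and H' :: "real measure"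
  assume H': "prob_space H' \<and> sets H' = sets borel \<and> (\<forall>x. emeasure H' {x} = 0) \<and>
    poisson_random_measure M' N' (mean_measure rho H')"
  then have "levy_prm M' N' rho H'"
    using rho_sets rho_supp rho_levy rho_inf tau1 by (auto intro: levy_prm.intro)
  then show "AE w in M'. ((\<lambda>a. SUP x. \<bar>measure (hnrmi N' a w) {..x} - measure H' {..x}\<bar>) \<longlongrightarrow> 0) at_top"
    using H' by (intro hnrmi_Glivenko_Cantelli) auto
qed

end
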